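(* Let $c \in \mathbb{N}$. For every $d \in \mathbb{N}$ let $\mathbf{k}(d), \mathfrak{d}_1^d, \mathfrak{d}_2^d, \ldots, \mathfrak{d}_{\mathbf{k}(d)+1}^d \in [c d^c]$. For every $d \in \mathbb{N}$, $i \in [\mathbf{k}(d)]$ let $Q_i^d \subseteq [-c d^c, c d^c]^{\mathfrak{d}_i^d}$ be a $\mathfrak{d}_i^d$-dimensional hypercube and let $g_i^d \in C(Q_i^d, \mathbb{R}^{\mathfrak{d}_{i+1}^d})$ be a function. Assume for every $d \in \mathbb{N}$, $i \in [\mathbf{k}(d)]$ that $$g_i^d \in \mathscr{P}_{c,1}(Q_i^d, 1) \cup \mathbf{M}(Q_i^d) \cup \mathbf{P}(Q_i^d).$$ Assume for all $d \in \mathbb{N}$, $i \in [\mathbf{k}(d)-1]$ that $g_i^d(Q_i^d) \subseteq Q_{i+1}^d$. Assume for all $d \in \mathbb{N}$, $i \in [\mathbf{k}(d)]$ with $g_i^d \in \mathbf{P}(Q_i^d)$ that $Q_i^d \subseteq [-\frac{1}{8}, \frac{1}{8}]^{\mathfrak{d}_i^d}$. For every $d \in \mathbb{N}$ let $F_d \in C(Q_1^d, \mathbb{R}^{\mathfrak{d}_{\mathbf{k}(d)+1}^d})$ satisfy $F_d = g^d_{\mathbf{k}(d)} \circ g^d_{\mathbf{k}(d)-1} \circ \cdots \circ g^d_1$. Then there exists $K \in \mathbb{N}$ such that for every $d \in \mathbb{N}$, $\varepsilon \in (0,1]$ there exists $\Phi \in \mathbf{N}$ such that $\mathcal{R}(\Phi)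 \in C(\mathbb{R}^{\mathfrak{d}_1^d}, \mathbb{R}^{\mathfrak{d}_{\mathbf{k}(d)+1}^d})$, $$\mathcal{P}(\Phi) \le K d^K \varepsilon^{-2c}, \qquad \text{and} \qquad \forall\, x \in Q_1^d \colon \ \| \mathcal{R}(\Phi)(x) - F_d(x) \|_1 \le \varepsilon .$$
   Context: Notation: $\mathbb{N} = \{1,2,\ldots\}$ and $[n] = \{1,2,\ldots,n\}$ for $n \in \mathbb{N} \cup \{0\}$ (so $[0]=\emptyset$). $C(X,Y)$ is the set of continuous functions from $X$ to $Y$. For $p \in [1,\infty]$, $\|\cdot\|_p$ is the usual $\ell_p$-norm on $\mathbb{R}^d$. Neural networks: $\mathbf{N} = \bigcup_{L \in \mathbb{N}} \bigcup_{\ell_0, \ldots, \ell_L \in \mathbb{N}} \prod_{k=1}^L (\mathbb{R}^{\ell_k \times \ell_{k-1}} \times \mathbb{R}^{\ell_k})$ is the set of deep neural networks. Let $\mathfrak{r}$ be the componentwise ReLU, $\mathfrak{r}(x_1,\ldots,x_d) = (\max\{x_1,0\},\ldots,\max\{x_d,0\})$. For $\Phi = ((W_1,b_1),\ldots,(W_L,b_L)) \in \prod_{k=1}^L (\mathbb{R}^{\ell_k\times\ell_{k-1}} \times \mathbb{R}^{\ell_k})$ put $\mathcal{A}_i^\Phi(x) = W_i x + b_i$; the realization $\mathcal{R}(\Phi) \in C(\mathbb{R}^{\ell_0}, \mathbb{R}^{\ell_L})$ is $\mathcal{R}(\Phi)(x) = \mathcal{A}_L^\Phi(\mathfrak{r}(\mathcal{A}_{L-1}^\Phi(\mathfrak{r}(\cdots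 \mathfrak{r}(\mathcal{A}_1^\Phi(x)) \cdots))))$ (no activation after the last layer), and the number of parameters is $\mathcal{P}(\Phi) = \sum_{i=1}^L \ell_i(\ell_{i-1}+1)$. A ($d$-dimensional) hypercube is a set of the form $[a,b]^d \subseteq \mathbb{R}^d$ with $a \in \mathbb{R}$, $b \in (a,\infty)$. Parallelization: for $f_i \colon A_i \to \mathbb{R}^{e_i}$ with $A_i \subseteq \mathbb{R}^{d_i}$, $i \in [n]$, the function $f_1 \square \cdots \square f_n \colon A_1 \times \cdots \times A_n \to \mathbb{R}^{e_1+\cdots+e_n}$ is $(f_1 \square \cdots \square f_n)(x_1,\ldots,x_n) = (f_1(x_1),\ldots,f_n(x_n))$. For $d \in \mathbb{N}$, $x \in \mathbb{R}^d$ let $m_d(x) = \max\{x_1,\ldots,x_d\}$ and $p_d(x) = \prod_{i=1}^d x_i$. Function classes: let $Q = [a,b]^d$ be a hypercube. - For $k \in \mathbb{N}$, $p \in [1,\infty]$, $L \in [0,\infty)$, $\mathscr{P}_{k,p}(Q,L)$ is the set of all continuous functions $f$ on $Q$ for which there exist $n, d_1,\ldots,d_n \in \mathbb{N}$ and functions $f_i \colon [a,b]^{d_i} \to \mathbb{R}$, $i \in [n]$, with $\sum_{i=1}^n d_i = d$, $\max_{i} d_i \le k$, $|f_i(x)-f_i(y)| \le L\|x-y\|_p$ for all $i \in [n]$, $x,y \in [a,b]^{d_i}$, and $f = f_1 \square \cdots \square f_n$. - $\mathbf{M}(Q)$ is the set of all functions on $Q$ of the form $m_{d_1}|_{[a,b]^{d_1}}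 \square \cdots \square m_{d_n}|_{[a,b]^{d_n}}$ with $n, d_1,\ldots,d_n \in \mathbb{N}$, $\sum_i d_i = d$. - $\mathbf{P}(Q)$ is the set of all functions on $Q$ of the form $p_{d_1}|_{[a,b]^{d_1}} \square \cdots \square p_{d_n}|_{[a,b]^{d_n}}$ with $n, d_1,\ldots,d_n \in \mathbb{N}$, $\sum_i d_i = d$. *)

theory Defs
  imports "HOL-Analysis.Analysis" "Jordan_Normal_Form.Matrix"
begin

unbundle no vec_syntax
hide_type (open) Finite_Cartesian_Product.vec
hide_const (open) Finite_Cartesian_Product.vec Finite_Cartesian_Product.mat
  Finite_Cartesian_Product.row

text \<open>
  \<open>\<real>\<^sup>d\<close> is the set \<open>carrier_vec d\<close> of real vectors of dimension \<open>d\<close>; coordinates are numbered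
  from 0. A function defined on \<open>A \<subseteq> \<real>\<^sup>d\<close> is represented by a total function on vectors of which
  only the values on \<open>A\<close> matter; accordingly, the function classes below constrain values on their
  domain only.
\<close>

definition vec_topology :: "nat \<Rightarrow> real vec topology" where
  "vec_topology d =
     pullback_topology (carrier_vec d) (\<lambda>x i. if i < d then x $ i else 0) (Euclidean_space d)"

text \<open>\<open>cont_funs d X e\<close> is \<open>C(X, \<real>\<^sup>e)\<close> for \<open>X \<subseteq> \<real>\<^sup>d\<close>.\<close>

definition cont_funs :: "nat \<Rightarrow> real vec set \<Rightarrow> nat \<Rightarrow> (real vec \<Rightarrow> real vec) set" where
  "cont_funs d X e = {f. continuous_map (subtopology (vec_topology d) X) (vec_topology e) f}"

text \<open>The \<open>\<ell>\<^sub>p\<close>-norm for \<open>p \<in> [1, \<infinity>]\<close>.\<close>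

definition lp_norm :: "ereal \<Rightarrow> real vec \<Rightarrow> real" where
  "lp_norm p x =
     (if p = \<infinity> then Max (insert 0 ((\<lambda>i. \<bar>x $ i\<bar>) ` {..<dim_vec x}))
      else (\<Sum>i<dim_vec x. \<bar>x $ i\<bar> powr real_of_ereal p) powr (1 / real_of_ereal p))"


subsection \<open>Neural networks\<close>

type_synonym network = "(real mat \<times> real vec) list"

definition has_architecture :: "network \<Rightarrow> nat list \<Rightarrow> bool" where
  "has_architecture \<Phi> l \<longleftrightarrow>
     length l = length \<Phi> + 1 \<and> (\<forall>k < length l. 1 \<le> l ! k) \<and>
     (\<forall>k < length \<Phi>. fst (\<Phi> ! k) \<in> carrier_mat (l ! (k + 1)) (l ! k) \<and>
                      snd (\<Phi> ! k) \<in> carrier_vec (l ! (k + 1)))"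

definition networks :: "network set" where
  "networks = {\<Phi>. \<Phi> \<noteq> [] \<and> (\<exists>l. has_architecture \<Phi> l)}"

definition in_dim :: "network \<Rightarrow> nat" where
  "in_dim \<Phi> = dim_col (fst (hd \<Phi>))"

definition out_dim :: "network \<Rightarrow> nat" where
  "out_dim \<Phi> = dim_row (fst (last \<Phi>))"

definition relu :: "real vec \<Rightarrow> real vec" where
  "relu x = map_vec (\<lambda>t. max t 0) x"

definition affine :: "real mat \<times> real vec \<Rightarrow> real vec \<Rightarrow> real vec" where
  "affine A x = fst A *\<^sub>v x + snd A"

text \<open>The empty list is not a network; its equation is junk.\<close>

fun realize :: "network \<Rightarrow> real vec \<Rightarrow> real vec" where
  "realize [] x = x"
| "realize [A] x = affine A x"
| "realize (A # B # \<Phi>) x = realize (B # \<Phi>) (relu (affine A x))"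

definition num_params :: "network \<Rightarrow> nat" where
  "num_params \<Phi> = (\<Sum>A\<leftarrow>\<Phi>. dim_row (fst A) * (dim_col (fst A) + 1))"


subsection \<open>Function classes\<close>

definition cube :: "nat \<Rightarrow> real \<Rightarrow> real \<Rightarrow> real vec set" where
  "cube d a b = {x \<in> carrier_vec d. \<forall>i<d. a \<le> x $ i \<and> x $ i \<le> b}"

definition is_hypercube :: "nat \<Rightarrow> real vec set \<Rightarrow> bool" where
  "is_hypercube d Q \<longleftrightarrow> (\<exists>a b. a < b \<and> Q = cube d a b)"

text \<open>
  Each function comes with the dimension of its domain. The argument is cut into consecutive blocks
  of these dimensions, so \<open>A\<^sub>1 \<times> \<dots> \<times> A\<^sub>n\<close> is identified with a subset of \<open>\<real>\<close> to the power
  \<open>d\<^sub>1 + \<dots> + d\<^sub>n\<close>.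
\<close>

fun parallel :: "(nat \<times> (real vec \<Rightarrow> real vec)) list \<Rightarrow> real vec \<Rightarrow> real vec" where
  "parallel [] x = vNil"
| "parallel ((d, f) # fs) x = f (vec_first x d) @\<^sub>v parallel fs (vec_last x (dim_vec x - d))"

text \<open>The identification of \<open>\<real>\<close> with \<open>\<real>\<^sup>1\<close> in the codomain.\<close>

definition scalar_fun :: "(real vec \<Rightarrow> real) \<Rightarrow> real vec \<Rightarrow> real vec" where
  "scalar_fun f x = vec 1 (\<lambda>_. f x)"

definition max_coord :: "real vec \<Rightarrow> real" where
  "max_coord x = Max ((\<lambda>i. x $ i) ` {..<dim_vec x})"

definition prod_coord :: "real vec \<Rightarrow> real" where
  "prod_coord x = (\<Prod>i<dim_vec x. x $ i)"

text \<open>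
  In the next three definitions \<open>d\<close>, \<open>a\<close>, \<open>b\<close> are uniquely determined by \<open>Q\<close>, as \<open>Q = [a, b]\<^sup>d\<close>
  with \<open>d \<ge> 1\<close> and \<open>a < b\<close>.
\<close>

definition lipschitz_class ::
    "nat \<Rightarrow> ereal \<Rightarrow> real vec set \<Rightarrow> real \<Rightarrow> (real vec \<Rightarrow> real vec) set" where
  "lipschitz_class k p Q L = {f. \<exists>d a b. 1 \<le> d \<and> a < b \<and> Q = cube d a b \<and>
     (\<exists>fs :: (nat \<times> (real vec \<Rightarrow> real)) list. fs \<noteq> [] \<and>
        f \<in> cont_funs d Q (length fs) \<and>
        (\<forall>(e, h) \<in> set fs. 1 \<le> e \<and> e \<le> k \<and>
           (\<forall>x \<in> cube e a b. \<forall>y \<in> cube e a b. \<bar>h x - h y\<bar> \<le> L * lp_norm p (x - y))) \<and>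
        sum_list (map fst fs) = d \<and>
        (\<forall>x \<in> Q. f x = parallel (map (\<lambda>(e, h). (e, scalar_fun h)) fs) x))}"

definition max_class :: "real vec set \<Rightarrow> (real vec \<Rightarrow> real vec) set" where
  "max_class Q = {f. \<exists>d a b. 1 \<le> d \<and> a < b \<and> Q = cube d a b \<and>
     (\<exists>ds. ds \<noteq> [] \<and> (\<forall>e \<in> set ds. 1 \<le> e) \<and> sum_list ds = d \<and>
        (\<forall>x \<in> Q. f x = parallel (map (\<lambda>e. (e, scalar_fun max_coord)) ds) x))}"

definition prod_class :: "real vec set \<Rightarrow> (real vec \<Rightarrow> real vec) set" where
  "prod_class Q = {f. \<exists>d a b. 1 \<le> d \<and> a < b \<and> Q = cube d a b \<and>
     (\<exists>ds. ds \<noteq> [] \<and> (\<forall>e \<in> set ds. 1 \<le> e) \<and> sum_list ds = d \<and>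
        (\<forall>x \<in> Q. f x = parallel (map (\<lambda>e. (e, scalar_fun prod_coord)) ds) x))}"

end

theory Submission
  imports Defs
begin

text \<open>
  Maxima, and products on \<open>[-1/8, 1/8]\<close>, are iterated binary operations that are 1-Lipschitz for the
  \<open>\<ell>\<^sub>1\<close>-norm. Hence every \<open>g\<^sub>i\<close> is a composition of polynomially many steps, each of which replaces a
  block of at most \<open>m = 2 c\<close> consecutive coordinates by a 1-Lipschitz function of them.
  Such a function \<open>f\<close> is approximated by the maximum of \<open>f y - \<parallel>x - y\<parallel>\<^sub>1\<close> over the points \<open>y\<close> of a grid,
  which a network of polynomial width computes as a running maximum, with two hidden layers per
  grid point. The approximation is stable outside the domain of \<open>f\<close>, so the errors of successive
  steps add up and a precision of order \<open>\<epsilon>\<close> divided by the number of steps suffices. A grid for this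
  precision has at most \<open>(poly(d) / \<epsilon>)\<^sup>m\<close> points; since the width does not depend on \<open>\<epsilon>\<close>, the number
  of parameters is of the same order.
\<close>

subsection \<open>Networks of bounded width\<close>

text \<open>The bound \<open>W\<close> concerns the hidden layers only; input and output dimensions
  stay free, so that affine pieces of any size can be glued together. \<open>H\<close> counts hidden
  layers rather than affine maps, because this count is additive under composition.\<close>

inductive relu_net :: "nat \<Rightarrow> nat \<Rightarrow> nat \<Rightarrow> nat \<Rightarrow> network \<Rightarrow> bool" for W :: nat where
  output_layer: "A \<in> carrier_mat m n \<Longrightarrow> b \<in> carrier_vec m \<Longrightarrow> relu_net W n m 0 [(A, b)]"
| hidden_layer: "A \<in> carrier_mat k n \<Longrightarrow> b \<in> carrier_vec k \<Longrightarrow> 1 \<le> k \<Longrightarrow> k \<le> W \<Longrightarrow>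
    relu_net W k m H \<Phi> \<Longrightarrow> relu_net W n m (Suc H) ((A, b) # \<Phi>)"

lemma relu_net_not_Nil: "relu_net W n m H \<Phi> \<Longrightarrow> \<Phi> \<noteq> []"
  by (induction rule: relu_net.induct) auto

lemma realize_Cons:
  "\<Phi> \<noteq> [] \<Longrightarrow> realize (A # \<Phi>) x = realize \<Phi> (relu (affine A x))"
  by (cases \<Phi>) auto

lemma affine_carrier [simp]:
  "A \<in> carrier_mat m n \<Longrightarrow> b \<in> carrier_vec m \<Longrightarrow> x \<in> carrier_vec n \<Longrightarrow> affine (A, b) x \<in> carrier_vec m"
  by (auto simp: affine_def)

lemma relu_carrier [simp]: "x \<in> carrier_vec n \<Longrightarrow> relu x \<in> carrier_vec n"
  by (auto simp: relu_def)

lemma relu_net_realize_carrier: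
  "relu_net W n m H \<Phi> \<Longrightarrow> x \<in> carrier_vec n \<Longrightarrow> realize \<Phi> x \<in> carrier_vec m"
  by (induction arbitrary: x rule: relu_net.induct)
    (auto simp: realize_Cons relu_net_not_Nil)

lemma relu_net_in_dim: "relu_net W n m H \<Phi> \<Longrightarrow> in_dim \<Phi> = n"
  by (induction rule: relu_net.induct) (auto simp: in_dim_def)

lemma relu_net_out_dim: "relu_net W n m H \<Phi> \<Longrightarrow> out_dim \<Phi> = m"
  by (induction rule: relu_net.induct) (auto simp: out_dim_def relu_net_not_Nil)

text \<open>The conclusion \<open>hd l = n\<close> lets the induction prepend a further dimension.
  The rules force only the hidden dimensions to be positive, so positivity of \<open>n\<close> and
  \<open>m\<close> is assumed.\<close>

lemma relu_net_architecture:
  assumes "relu_net W n m H \<Phi>" "1 \<le> n" "1 \<le> m"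
  shows "\<exists>l. has_architecture \<Phi> l \<and> l \<noteq> [] \<and> hd l = n"
  using assms
proof (induction rule: relu_net.induct)
  case (output_layer A m n b)
  then have "has_architecture [(A, b)] [n, m]"
    by (auto simp: has_architecture_def less_Suc_eq)
  then show ?case by fastforce
next
  case (hidden_layer A k n b m H \<Phi>)
  then obtain l where l: "has_architecture \<Phi> l" "l \<noteq> []" "hd l = k" by auto
  then have "has_architecture ((A, b) # \<Phi>) (n # l)"
    using hidden_layer
    by (auto simp: has_architecture_def nth_Cons hd_conv_nth split: nat.splits)
  then show ?case by fastforce
qed

lemma relu_net_networks:
  "relu_net W n m H \<Phi> \<Longrightarrow> 1 \<le> n \<Longrightarrow> 1 \<le> m \<Longrightarrow> \<Phi> \<in> networks"
  using relu_net_architecture relu_net_not_Nil by (fastforce simp: networks_def)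

text \<open>At fixed width the parameter count is linear in the depth: each of the
  \<open>H + 1\<close> affine maps has at most \<open>W * (W + 1)\<close> parameters. Hence long
  networks of small width give the right power of \<epsilon>.\<close>

lemma relu_net_num_params:
  assumes "relu_net W n m H \<Phi>" "n \<le> W" "m \<le> W"
  shows "num_params \<Phi> \<le> (H + 1) * (W * (W + 1))"
  using assms
proof (induction rule: relu_net.induct)
  case (output_layer A m n b)
  then show ?case using mult_le_mono[of m W "n + 1" "W + 1"] by (simp add: num_params_def)
next
  case (hidden_layer A k n b m H \<Phi>)
  then show ?case using mult_le_mono[of k W "n + 1" "W + 1"] by (simp add: num_params_def)
qed

lemma affine_comp:
  assumes "A \<in> carrier_mat k n" "a \<in> carrier_vec k" "B \<in> carrier_mat m k" "b \<in> carrier_vec m"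
    "x \<in> carrier_vec n"
  shows "affine (B * A, B *\<^sub>v a + b) x = affine (B, b) (affine (A, a) x)"
  using assms
  by (simp add: affine_def mult_add_distrib_mat_vec[of _ m k] assoc_add_vec[of _ m])

text \<open>The last affine map of \<open>\<Phi>\<close> and the first of \<open>\<Psi>\<close>
  merge into one, since no ReLU stands between them. So the numbers of hidden layers add exactly,
  and the intermediate dimension \<open>k\<close>, which may exceed \<open>W\<close>,
  disappears.\<close>

lemma relu_net_comp:
  assumes "relu_net W n k H\<^sub>1 \<Phi>" "relu_net W k m H\<^sub>2 \<Psi>"
  shows "\<exists>X. relu_net W n m (H\<^sub>1 + H\<^sub>2) X \<and>
    (\<forall>x \<in> carrier_vec n. realize X x = realize \<Psi> (realize \<Phi> x))"
  using assms
proof (induction arbitrary: \<Psi> rule: relu_net.induct)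
  case (output_layer A k n a)
  from output_layer.prems show ?case
  proof cases
    case (output_layer B b)
    have "relu_net W n m 0 [(B * A, B *\<^sub>v a + b)]"
      using output_layer \<open>A \<in> _\<close> \<open>a \<in> _\<close> by (intro relu_net.output_layer) auto
    then show ?thesis
      using output_layer \<open>A \<in> _\<close> \<open>a \<in> _\<close> affine_comp[of A k n a B m b] by fastforce
  next
    case (hidden_layer B j b H \<Phi>)
    have "relu_net W n m (Suc H) ((B * A, B *\<^sub>v a + b) # \<Phi>)"
      using hidden_layer \<open>A \<in> _\<close> \<open>a \<in> _\<close> by (intro relu_net.hidden_layer[of _ j]) auto
    then show ?thesis
      using hidden_layer \<open>A \<in> _\<close> \<open>a \<in> _\<close> affine_comp[of A k n a B j b]
      by (intro exI[of _ "(B * A, B *\<^sub>v a + b) # \<Phi>"]) (auto simp: realize_Cons relu_net_not_Nil)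
  qed
next
  case (hidden_layer A j n b k H \<Phi>)
  from hidden_layer.IH[OF hidden_layer.prems] obtain X where
    X: "relu_net W j m (H + H\<^sub>2) X" "\<forall>x \<in> carrier_vec j. realize X x = realize \<Psi> (realize \<Phi> x)"
    by blast
  have "relu_net W n m (Suc (H + H\<^sub>2)) ((A, b) # X)"
    using hidden_layer X by (intro relu_net.hidden_layer[of _ j]) auto
  then show ?case
    using hidden_layer X
    by (intro exI[of _ "(A, b) # X"]) (auto simp: realize_Cons relu_net_not_Nil)
qed

section \<open>Functions computed by networks of given width and depth\<close>

definition relu_computable ::
    "nat \<Rightarrow> nat \<Rightarrow> nat \<Rightarrow> nat \<Rightarrow> (real vec \<Rightarrow> real vec) \<Rightarrow> bool" where
  "relu_computable W n m H f \<longleftrightarrow>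
    (\<exists>\<Phi>. relu_net W n m H \<Phi> \<and> (\<forall>x \<in> carrier_vec n. realize \<Phi> x = f x))"

lemma relu_computable_carrier:
  "relu_computable W n m H f \<Longrightarrow> x \<in> carrier_vec n \<Longrightarrow> f x \<in> carrier_vec m"
  unfolding relu_computable_def using relu_net_realize_carrier by metis

lemma relu_computable_comp:
  assumes "relu_computable W n k H\<^sub>1 f" "relu_computable W k m H\<^sub>2 g"
  shows "relu_computable W n m (H\<^sub>1 + H\<^sub>2) (\<lambda>x. g (f x))"
proof -
  from assms obtain \<Phi> \<Psi> where
    \<Phi>: "relu_net W n k H\<^sub>1 \<Phi>" "\<forall>x \<in> carrier_vec n. realize \<Phi> x = f x" and
    \<Psi>: "relu_net W k m H\<^sub>2 \<Psi>" "\<forall>x \<in> carrier_vec k. realize \<Psi> x = g x"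
    unfolding relu_computable_def by blast
  from relu_net_comp[OF \<Phi>(1) \<Psi>(1)] obtain X where
    "relu_net W n m (H\<^sub>1 + H\<^sub>2) X" "\<forall>x \<in> carrier_vec n. realize X x = realize \<Psi> (realize \<Phi> x)"
    by blast
  then show ?thesis
    unfolding relu_computable_def using \<Phi> \<Psi> relu_net_realize_carrier
    by (intro exI[of _ X]) metis
qed

lemma relu_computable_cong:
  "relu_computable W n m H f \<Longrightarrow> (\<And>x. x \<in> carrier_vec n \<Longrightarrow> f x = g x) \<Longrightarrow>
    relu_computable W n m H g"
  unfolding relu_computable_def by metis

section \<open>Affine maps and networks with one hidden layer\<close>

definition affine_fun :: "nat \<Rightarrow> (real vec \<Rightarrow> real) \<Rightarrow> bool" where
  "affine_fun n p \<longleftrightarrow> (\<exists>a b. \<forall>x \<in> carrier_vec n. p x = (\<Sum>j<n. a j * x $ j) + b)"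

lemma affine_fun_coord [intro]: "i < n \<Longrightarrow> affine_fun n (\<lambda>x. x $ i)"
  unfolding affine_fun_def
  by (rule exI[of _ "\<lambda>j. if j = i then 1 else 0"], rule exI[of _ 0])
    (simp add: if_distrib[of "\<lambda>t. t * _"] cong: if_cong)

lemma affine_fun_const [intro]: "affine_fun n (\<lambda>x. c)"
  unfolding affine_fun_def by (rule exI[of _ "\<lambda>_. 0"], rule exI[of _ c]) simp

lemma affine_fun_cmult [intro]:
  assumes "affine_fun n p"
  shows "affine_fun n (\<lambda>x. c * p x)"
proof -
  from assms obtain a b where "\<forall>x \<in> carrier_vec n. p x = (\<Sum>j<n. a j * x $ j) + b"
    unfolding affine_fun_def by blast
  then show ?thesis
    unfolding affine_fun_def
    by (intro exI[of _ "\<lambda>j. c * a j"] exI[of _ "c * b"])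
      (simp add: algebra_simps sum_distrib_left)
qed

lemma affine_fun_add [intro]:
  assumes "affine_fun n p" "affine_fun n q"
  shows "affine_fun n (\<lambda>x. p x + q x)"
proof -
  from assms obtain a b a' b' where "\<forall>x \<in> carrier_vec n. p x = (\<Sum>j<n. a j * x $ j) + b"
    "\<forall>x \<in> carrier_vec n. q x = (\<Sum>j<n. a' j * x $ j) + b'"
    unfolding affine_fun_def by blast
  then show ?thesis
    unfolding affine_fun_def
    by (intro exI[of _ "\<lambda>j. a j + a' j"] exI[of _ "b + b'"])
      (simp add: algebra_simps sum.distrib)
qed

lemma affine_fun_diff [intro]:
  "affine_fun n p \<Longrightarrow> affine_fun n q \<Longrightarrow> affine_fun n (\<lambda>x. p x - q x)"
  using affine_fun_add[of n p "\<lambda>x. -1 * q x"] affine_fun_cmult[of n q "-1"] by simp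

lemma affine_fun_sum [intro]:
  "(\<And>i. i \<in> I \<Longrightarrow> affine_fun n (p i)) \<Longrightarrow> affine_fun n (\<lambda>x. \<Sum>i\<in>I. p i x)"
  by (induction I rule: infinite_finite_induct) auto

lemma affine_fun_comp:
  assumes "affine_fun m p" "\<And>x. x \<in> carrier_vec n \<Longrightarrow> f x \<in> carrier_vec m"
    "\<And>i. i < m \<Longrightarrow> affine_fun n (\<lambda>x. f x $ i)"
  shows "affine_fun n (\<lambda>x. p (f x))"
proof -
  from assms obtain a b where "\<forall>y \<in> carrier_vec m. p y = (\<Sum>j<m. a j * y $ j) + b"
    unfolding affine_fun_def by blast
  then have "p (f x) = (\<Sum>j<m. a j * f x $ j) + b" if "x \<in> carrier_vec n" for x
    using that assms(2) by blast
  moreover have "affine_fun n (\<lambda>x. (\<Sum>j<m. a j * f x $ j) + b)"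
    by (intro affine_fun_add affine_fun_sum affine_fun_cmult assms(3)) auto
  ultimately show ?thesis
    unfolding affine_fun_def by simp
qed

text \<open>An affine map costs no hidden layer; padding, copying and permuting coordinates are
  therefore free.\<close>

lemma relu_computable_affine:
  assumes "\<And>x. x \<in> carrier_vec n \<Longrightarrow> f x \<in> carrier_vec m"
    "\<And>i. i < m \<Longrightarrow> affine_fun n (\<lambda>x. f x $ i)"
  shows "relu_computable W n m 0 f"
proof -
  have "\<forall>i. \<exists>a b. i < m \<longrightarrow> (\<forall>x \<in> carrier_vec n. f x $ i = (\<Sum>j<n. a j * x $ j) + b)"
    using assms(2) unfolding affine_fun_def by blast
  then obtain a b where
    ab: "\<And>i x. i < m \<Longrightarrow> x \<in> carrier_vec n \<Longrightarrow> f x $ i = (\<Sum>j<n. a i j * x $ j) + b i"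
    by metis
  let ?A = "mat m n (\<lambda>(i, j). a i j)" and ?b = "vec m b"
  have "realize [(?A, ?b)] x = f x" if "x \<in> carrier_vec n" for x
    using that assms(1)[OF that] ab[OF _ that]
    by (intro eq_vecI) (auto simp: affine_def scalar_prod_def atLeast0LessThan)
  then show ?thesis
    unfolding relu_computable_def by (meson relu_net.output_layer mat_carrier vec_carrier)
qed

lemma relu_computable_relu:
  assumes "1 \<le> n" "n \<le> W"
  shows "relu_computable W n n 1 relu"
proof -
  have "relu_net W n n (Suc 0) [(1\<^sub>m n, 0\<^sub>v n), (1\<^sub>m n, 0\<^sub>v n)]"
    using assms by (intro relu_net.intros) auto
  then show ?thesis
    unfolding relu_computable_def
    by (intro exI[of _ "[(1\<^sub>m n, 0\<^sub>v n), (1\<^sub>m n, 0\<^sub>v n)]"])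
      (auto simp: affine_def relu_carrier)
qed

text \<open>The identity \<open>t = max t 0 - max (- t) 0\<close> lets affine data pass through the hidden layer.\<close>

lemma relu_computable_shallow:
  assumes "1 \<le> n" "2 * n + T \<le> W" "\<And>x. x \<in> carrier_vec n \<Longrightarrow> f x \<in> carrier_vec m"
    "\<And>x i. x \<in> carrier_vec n \<Longrightarrow> i < m \<Longrightarrow>
      f x $ i = p i x + (\<Sum>t<T. \<alpha> i t * max (q t x) 0)"
    "\<And>i. i < m \<Longrightarrow> affine_fun n (p i)" "\<And>t. t < T \<Longrightarrow> affine_fun n (q t)"
  shows "relu_computable W n m 1 f"
proof -
  \<comment> \<open>The hidden layer holds \<open>x\<close>, its negative and the arguments
    \<open>q t x\<close>, whence the width \<open>2 * n + T\<close>. After the ReLU,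
    \<open>dec\<close> recovers \<open>x\<close>, so that \<open>h\<close> can evaluate the affine
    parts \<open>p i\<close>.\<close>
  define g where "g x = vec (2 * n + T) (\<lambda>i. if i < n then x $ i else
    if i < 2 * n then - 1 * x $ (i - n) else q (i - 2 * n) x)" for x
  define dec where "dec z = vec n (\<lambda>j. z $ j - z $ (n + j))" for z :: "real vec"
  define h where
    "h z = vec m (\<lambda>i. p i (dec z) + (\<Sum>t<T. \<alpha> i t * z $ (2 * n + t)))" for z :: "real vec"
  have "relu_computable W n (2 * n + T) 0 g"
  proof (rule relu_computable_affine)
    fix i assume "i < 2 * n + T"
    consider "i < n" | "n \<le> i" "i < 2 * n" | "2 * n \<le> i" by linarith
    then show "affine_fun n (\<lambda>x. g x $ i)"
    proof cases
      case 1
      then show ?thesis by (auto simp: g_def)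
    next
      case 2
      then have "affine_fun n (\<lambda>x. - 1 * x $ (i - n))"
        by (intro affine_fun_cmult affine_fun_coord) auto
      with 2 show ?thesis by (simp add: g_def)
    next
      case 3
      with \<open>i < 2 * n + T\<close> assms(6)[of "i - 2 * n"] show ?thesis by (simp add: g_def)
    qed
  qed (simp add: g_def)
  moreover have "relu_computable W (2 * n + T) (2 * n + T) 1 relu"
    using assms by (intro relu_computable_relu) auto
  moreover have "relu_computable W (2 * n + T) m 0 h"
  proof (rule relu_computable_affine)
    fix i assume i: "i < m"
    have "affine_fun (2 * n + T) (\<lambda>z. p i (dec z))"
    proof (rule affine_fun_comp[OF assms(5)[OF i]])
      show "affine_fun (2 * n + T) (\<lambda>z. dec z $ j)" if "j < n" for j
        using that by (auto simp: dec_def intro!: affine_fun_diff)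
    qed (simp add: dec_def)
    then show "affine_fun (2 * n + T) (\<lambda>z. h z $ i)"
      using i by (auto simp: h_def intro!: affine_fun_add affine_fun_sum affine_fun_cmult)
  qed (simp add: h_def)
  ultimately have "relu_computable W n m 1 (\<lambda>x. h (relu (g x)))"
    using relu_computable_comp[of W n "2 * n + T" 0 g "2 * n + T" 1 relu]
      relu_computable_comp[of W n "2 * n + T" 1 "\<lambda>x. relu (g x)" m 0 h] by simp
  then show ?thesis
  proof (rule relu_computable_cong)
    fix x :: "real vec" assume x: "x \<in> carrier_vec n"
    have "dec (relu (g x)) = x"
      using x by (intro eq_vecI) (auto simp: dec_def relu_def g_def max_def)
    then show "h (relu (g x)) = f x"
      using x assms(3,4)[OF x] by (intro eq_vecI) (auto simp: h_def relu_def g_def)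
  qed
qed

subsection \<open>Continuity of realizations\<close>

lemma vec_topology_topspace: "topspace (vec_topology n) = carrier_vec n"
  by (auto simp: vec_topology_def topspace_pullback_topology topspace_Euclidean_space)

lemma cont_funs_carrier:
  "f \<in> cont_funs n X m \<Longrightarrow> X \<subseteq> carrier_vec n \<Longrightarrow> x \<in> X \<Longrightarrow> f x \<in> carrier_vec m"
  by (fastforce simp: cont_funs_def vec_topology_topspace dest!: continuous_map_image_subset_topspace)

lemma continuous_map_vec_coord:
  assumes "i < n"
  shows "continuous_map (vec_topology n) euclideanreal (\<lambda>x. x $ i)"
proof -
  have "continuous_map (Euclidean_space n) euclideanreal (\<lambda>y. y i)"
    unfolding Euclidean_space_def
    by (intro continuous_map_from_subtopology continuous_map_product_projection) simp
  from continuous_map_pullback[OF this, of "carrier_vec n" "\<lambda>x i. if i < n then x $ i else 0"]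
  show ?thesis using assms by (simp add: vec_topology_def o_def)
qed

text \<open>The topology is a pullback along the coordinate map, so continuity can be checked one
  coordinate at a time.\<close>

lemma continuous_map_vec_topology:
  assumes "\<And>x. x \<in> topspace X \<Longrightarrow> f x \<in> carrier_vec m"
    "\<And>i. i < m \<Longrightarrow> continuous_map X euclideanreal (\<lambda>x. f x $ i)"
  shows "continuous_map X (vec_topology m) f"
  unfolding vec_topology_def
  using assms
  by (intro continuous_map_pullback') (auto simp: o_def continuous_map_componentwise_Euclidean_space)

lemma continuous_map_affine:
  assumes "A \<in> carrier_mat m n" "b \<in> carrier_vec m"
  shows "continuous_map (vec_topology n) (vec_topology m) (affine (A, b))"
proof (rule continuous_map_vec_topology)
  fix i assume "i < m"
  then have "continuous_map (vec_topology n) euclideanreal (\<lambda>x. (\<Sum>j<n. A $$ (i, j) * x $ j) + b $ i)"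
    by (intro continuous_map_add continuous_map_sum continuous_map_real_mult continuous_map_vec_coord) auto
  then show "continuous_map (vec_topology n) euclideanreal (\<lambda>x. affine (A, b) x $ i)"
    using assms \<open>i < m\<close>
    by (elim continuous_map_eq)
      (auto simp: vec_topology_topspace affine_def scalar_prod_def atLeast0LessThan)
qed (use assms in \<open>auto simp: vec_topology_topspace\<close>)

lemma continuous_map_relu: "continuous_map (vec_topology n) (vec_topology n) relu"
proof (rule continuous_map_vec_topology)
  fix i assume "i < n"
  then have "continuous_map (vec_topology n) euclideanreal (\<lambda>x. max (x $ i) 0)"
    by (intro continuous_map_real_max continuous_map_vec_coord) auto
  then show "continuous_map (vec_topology n) euclideanreal (\<lambda>x. relu x $ i)"
    using \<open>i < n\<close> by (elim continuous_map_eq) (auto simp: vec_topology_topspace relu_def)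
qed (auto simp: vec_topology_topspace)

lemma relu_net_continuous_map:
  "relu_net W n m H \<Phi> \<Longrightarrow> continuous_map (vec_topology n) (vec_topology m) (realize \<Phi>)"
proof (induction rule: relu_net.induct)
  case (output_layer A m n b)
  have "realize [(A, b)] = affine (A, b)" by (simp add: fun_eq_iff)
  then show ?case using output_layer continuous_map_affine by metis
next
  case (hidden_layer A k n b m H \<Phi>)
  have "realize ((A, b) # \<Phi>) = realize \<Phi> \<circ> (relu \<circ> affine (A, b))"
    using hidden_layer by (auto simp: fun_eq_iff realize_Cons relu_net_not_Nil)
  then show ?case
    using hidden_layer continuous_map_affine continuous_map_relu continuous_map_compose by metis
qed

lemma relu_net_cont_funs: "relu_net W n m H \<Phi> \<Longrightarrow> realize \<Phi> \<in> cont_funs n (carrier_vec n) m"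
  unfolding cont_funs_def
  by (auto intro: continuous_map_from_subtopology relu_net_continuous_map)

subsection \<open>Lower Lipschitz envelopes over a grid\<close>

text \<open>The dimension is an explicit argument and carriers are not mentioned, so symmetry and
  the triangle inequality hold for all vectors.\<close>

definition l1_dist :: "nat \<Rightarrow> real vec \<Rightarrow> real vec \<Rightarrow> real" where
  "l1_dist n x y = (\<Sum>i<n. \<bar>x $ i - y $ i\<bar>)"

lemma lp_norm_1_diff:
  assumes "x \<in> carrier_vec n" "y \<in> carrier_vec n"
  shows "lp_norm 1 (x - y) = l1_dist n x y"
proof -
  have "lp_norm 1 (x - y) = (\<Sum>i<n. \<bar>(x - y) $ i\<bar>)"
    using assms by (simp add: lp_norm_def sum_nonneg)
  then show ?thesis using assms by (simp add: l1_dist_def)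
qed

lemma l1_dist_commute: "l1_dist n x y = l1_dist n y x"
  by (simp add: l1_dist_def abs_minus_commute)

lemma l1_dist_triangle: "l1_dist n x z \<le> l1_dist n x y + l1_dist n y z"
  unfolding l1_dist_def sum.distrib[symmetric] by (intro sum_mono) linarith

lemma l1_dist_nonneg: "0 \<le> l1_dist n x y"
  by (simp add: l1_dist_def sum_nonneg)

lemma grid_point:
  fixes t :: real
  assumes "a < b" "0 < N" "a \<le> t" "t \<le> b"
  shows "\<exists>k \<le> N. \<bar>t - (a + (b - a) * real k / real N)\<bar> \<le> (b - a) / real N"
proof -
  \<comment> \<open>\<open>s\<close> is the position of \<open>t\<close> in units of the mesh width;
    rounding it down gives the index. The endpoint \<open>t = b\<close> gives \<open>k = N\<close>,
    so each axis has \<open>N + 1\<close> grid values.\<close>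
  define s where "s = (t - a) * real N / (b - a)"
  have s: "0 \<le> s" "s \<le> real N"
    using assms mult_right_mono[of "t - a" "b - a" "real N"] by (auto simp: s_def field_simps)
  let ?k = "nat \<lfloor>s\<rfloor>"
  have k: "real ?k \<le> s" "\<bar>s - real ?k\<bar> \<le> 1" using s by linarith+
  have "?k \<le> N" using s by linarith
  moreover have "t - (a + (b - a) * real ?k / real N) = (s - real ?k) * ((b - a) / real N)"
    using assms by (simp add: s_def field_simps)
  moreover have "\<bar>(s - real ?k) * ((b - a) / real N)\<bar> \<le> 1 * ((b - a) / real N)"
    unfolding abs_mult using k(2) assms by (intro mult_mono) (auto simp del: of_nat_nat)
  ultimately show ?thesis by (metis mult_1)
qed

text \<open>A product grid: each of the \<open>e\<close> axes contributes at most one mesh width to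
  the distance. The points must lie in the cube because the function to be approximated is
  controlled only there.\<close>

lemma cube_l1_net:
  assumes "a < b" "0 < N"
  shows "\<exists>ys. set ys \<subseteq> cube e a b \<and> length ys \<le> (N + 1) ^ e \<and>
    (\<forall>x \<in> cube e a b. \<exists>y \<in> set ys. l1_dist e x y \<le> real e * ((b - a) / real N))"
proof -
  define pt where "pt \<kappa> = vec e (\<lambda>i. a + (b - a) * real (\<kappa> i) / real N)" for \<kappa> :: "nat \<Rightarrow> nat"
  define G where "G = pt ` ({..<e} \<rightarrow>\<^sub>E {..N})"
  have fin: "finite ({..<e} \<rightarrow>\<^sub>E {..N})" by (intro finite_PiE) auto
  then have "card G \<le> (N + 1) ^ e"
    unfolding G_def using card_image_le[OF fin, of pt] by (simp add: card_PiE)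
  moreover obtain ys where ys: "set ys = G" "distinct ys"
    using finite_distinct_list[of G] fin by (auto simp: G_def)
  moreover have "G \<subseteq> cube e a b"
  proof
    fix y assume "y \<in> G"
    then obtain \<kappa> where \<kappa>: "\<kappa> \<in> {..<e} \<rightarrow>\<^sub>E {..N}" "y = pt \<kappa>" unfolding G_def by blast
    have "0 \<le> (b - a) * real (\<kappa> i) / real N \<and> (b - a) * real (\<kappa> i) / real N \<le> b - a" if "i < e" for i
    proof -
      have "\<kappa> i \<le> N" using \<kappa> that by auto
      then have "(b - a) * real (\<kappa> i) \<le> (b - a) * real N"
        using assms by (intro mult_left_mono) auto
      then show ?thesis using assms by (simp add: pos_divide_le_eq)
    qed
    then show "y \<in> cube e a b" using \<kappa> by (fastforce simp: cube_def pt_def)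
  qed
  moreover have "\<exists>y \<in> G. l1_dist e x y \<le> real e * ((b - a) / real N)" if "x \<in> cube e a b" for x
  proof -
    have "\<forall>i. \<exists>k. i < e \<longrightarrow> k \<le> N \<and> \<bar>x $ i - (a + (b - a) * real k / real N)\<bar> \<le> (b - a) / real N"
      using that grid_point[OF assms] by (auto simp: cube_def)
    then obtain \<kappa> where \<kappa>: "\<And>i. i < e \<Longrightarrow> \<kappa> i \<le> N"
      "\<And>i. i < e \<Longrightarrow> \<bar>x $ i - (a + (b - a) * real (\<kappa> i) / real N)\<bar> \<le> (b - a) / real N" by metis
    \<comment> \<open>Restriction makes the index function extensional, hence an element of the set
      whose image is \<open>G\<close>.\<close>
    define \<kappa>' where "\<kappa>' = restrict \<kappa> {..<e}"
    have "pt \<kappa>' \<in> G" using \<kappa>(1) by (auto simp: G_def \<kappa>'_def)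
    moreover have "l1_dist e x (pt \<kappa>') \<le> (\<Sum>i<e. (b - a) / real N)"
      unfolding l1_dist_def by (intro sum_mono) (use \<kappa>(2) in \<open>auto simp: pt_def \<kappa>'_def\<close>)
    ultimately show ?thesis by auto
  qed
  ultimately show ?thesis by (metis distinct_card)
qed

text \<open>This is the McShane-Whitney lower Lipschitz extension from the points \<open>ys\<close>,
  truncated below by \<open>r\<close>. As a fold, it treats each point as an update of one register;
  the seed \<open>r\<close> avoids a maximum over an empty set.\<close>

definition lower_env :: "nat \<Rightarrow> (real vec \<Rightarrow> real) \<Rightarrow> real vec list \<Rightarrow> real \<Rightarrow> real vec \<Rightarrow> real" where
  "lower_env e f ys r x = fold (\<lambda>y r. max r (f y - l1_dist e x y)) ys r"

lemma lower_env_simps [simp]: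
  "lower_env e f [] r x = r"
  "lower_env e f (y # ys) r x = lower_env e f ys (max r (f y - l1_dist e x y)) x"
  by (auto simp: lower_env_def)

lemma lower_env_ge_init: "r \<le> lower_env e f ys r x"
  by (induction ys arbitrary: r) (use max.boundedE in \<open>auto, blast\<close>)

lemma lower_env_ge:
  "y \<in> set ys \<Longrightarrow> f y - l1_dist e x y \<le> lower_env e f ys r x"
  by (induction ys arbitrary: r) (auto intro: order.trans[OF _ lower_env_ge_init])

lemma lower_env_le:
  "r \<le> t \<Longrightarrow> (\<And>y. y \<in> set ys \<Longrightarrow> f y - l1_dist e x y \<le> t) \<Longrightarrow> lower_env e f ys r x \<le> t"
  by (induction ys arbitrary: r) auto

text \<open>By the Lipschitz property and the triangle inequality no term exceeds
  \<open>f x + l1_dist e x' x\<close>. Conversely, the term of the net point \<open>y\<close> loses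
  at most \<open>\<eta>\<close> in the value \<open>f y\<close> and \<open>\<eta>\<close> in the
  distance. The point \<open>x'\<close> is arbitrary, which gives the stability outside the
  domain.\<close>

lemma lower_env_approx:
  assumes lip: "\<And>x y. x \<in> S \<Longrightarrow> y \<in> S \<Longrightarrow> \<bar>f x - f y\<bar> \<le> l1_dist e x y"
    and "set ys \<subseteq> S" "x \<in> S" "r \<le> f x" "y \<in> set ys" "l1_dist e x y \<le> \<eta>"
  shows "\<bar>lower_env e f ys r x' - f x\<bar> \<le> l1_dist e x' x + 2 * \<eta>"
proof -
  have "f y - l1_dist e x' y \<le> lower_env e f ys r x'"
    by (rule lower_env_ge) fact
  moreover have "\<bar>f x - f y\<bar> \<le> l1_dist e x y" using assms by blast
  moreover have "l1_dist e x' y \<le> l1_dist e x' x + l1_dist e x y" by (rule l1_dist_triangle)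
  moreover have "lower_env e f ys r x' \<le> f x + l1_dist e x' x"
  proof (rule lower_env_le)
    show "r \<le> f x + l1_dist e x' x" using assms(4) l1_dist_nonneg[of e x' x] by linarith
    fix z assume "z \<in> set ys"
    then have "\<bar>f x - f z\<bar> \<le> l1_dist e x z" using assms by blast
    moreover have "l1_dist e x z \<le> l1_dist e x x' + l1_dist e x' z" by (rule l1_dist_triangle)
    ultimately show "f z - l1_dist e x' z \<le> f x + l1_dist e x' x"
      using l1_dist_commute[of e x x'] by linarith
  qed
  moreover have "0 \<le> \<eta>" using assms(6) l1_dist_nonneg[of e x y] by linarith
  ultimately show ?thesis using assms(6) by linarith
qed

section \<open>Networks for the envelope of a block of coordinates\<close>

definition subvec :: "nat \<Rightarrow> nat \<Rightarrow> real vec \<Rightarrow> real vec" where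
  "subvec p e s = vec e (\<lambda>j. s $ (p + j))"

lemma subvec_carrier [simp]: "subvec p e s \<in> carrier_vec e"
  by (simp add: subvec_def)

text \<open>Coordinate \<open>n\<close> is the register of the running maximum. For each point one
  hidden layer appends the new candidate as coordinate \<open>n + 1\<close> and a second one takes
  the maximum. The widths \<open>2 * (n + 1) + e\<close> and \<open>2 * (n + 2) + 1\<close> are both
  at most \<open>2 * n + 5 + e\<close>.\<close>

lemma relu_computable_lower_env:
  assumes "p + e \<le> n" "1 \<le> n" "2 * n + 5 + e \<le> W"
  shows "relu_computable W (n + 1) (n + 1) (2 * length ys)
    (\<lambda>s. vec (n + 1) (\<lambda>i. if i < n then s $ i else lower_env e f ys (s $ n) (subvec p e s)))"
proof (induction ys)
  case Nil
  have "relu_computable W (n + 1) (n + 1) 0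
    (\<lambda>s. vec (n + 1) (\<lambda>i. if i < n then s $ i else lower_env e f [] (s $ n) (subvec p e s)))"
    by (rule relu_computable_affine) (auto simp: less_Suc_eq intro!: affine_fun_coord)
  then show ?case by simp
next
  case (Cons y ys)
  define g where "g s = vec (n + 2) (\<lambda>i. if i < n + 1 then s $ i else f y - l1_dist e (subvec p e s) y)" for s
  define h where "h s = vec (n + 1) (\<lambda>i. if i < n then s $ i else max (s $ n) (s $ (n + 1)))" for s :: "real vec"
  have "relu_computable W (n + 1) (n + 2) 1 g"
  proof (rule relu_computable_shallow[where T = e and q = "\<lambda>t s. s $ (p + t) - y $ t" and
      p = "\<lambda>i s. if i < n + 1 then s $ i else f y + (\<Sum>t<e. s $ (p + t) - y $ t)" and
      \<alpha> = "\<lambda>i t. if i < n + 1 then 0 else - 2"])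
    fix s :: "real vec" and i assume s: "s \<in> carrier_vec (n + 1)" "i < n + 2"
    \<comment> \<open>This identity turns minus a sum of absolute values into an affine sum plus
      ReLU terms with coefficient \<open>- 2\<close>, whence the choice of \<open>p\<close> and
      \<open>\<alpha>\<close> above.\<close>
    have "\<bar>u\<bar> = 2 * max u 0 - u" for u :: real by (auto simp: max_def)
    then have "l1_dist e (subvec p e s) y = (\<Sum>t<e. 2 * max (s $ (p + t) - y $ t) 0 - (s $ (p + t) - y $ t))"
      by (auto simp: l1_dist_def subvec_def intro!: sum.cong)
    also have "\<dots> = (\<Sum>t<e. 2 * max (s $ (p + t) - y $ t) 0) - (\<Sum>t<e. s $ (p + t) - y $ t)"
      by (rule sum_subtractf)
    finally show "g s $ i = (if i < n + 1 then s $ i else f y + (\<Sum>t<e. s $ (p + t) - y $ t)) +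
        (\<Sum>t<e. (if i < n + 1 then 0 else - 2) * max (s $ (p + t) - y $ t) 0)"
      using s by (auto simp: g_def sum_negf)
  next
    fix i assume "i < n + 2"
    show "affine_fun (n + 1) (\<lambda>s. if i < n + 1 then s $ i else f y + (\<Sum>t<e. s $ (p + t) - y $ t))"
    proof (cases "i < n + 1")
      case False
      have "affine_fun (n + 1) (\<lambda>s. f y + (\<Sum>t<e. s $ (p + t) - y $ t))"
        using assms by (intro affine_fun_add affine_fun_sum affine_fun_diff affine_fun_coord affine_fun_const) auto
      with False show ?thesis by simp
    qed auto
  next
    fix t assume "t < e"
    then show "affine_fun (n + 1) (\<lambda>s. s $ (p + t) - y $ t)"
      using assms by (intro affine_fun_diff affine_fun_coord affine_fun_const) auto
  qed (use assms in \<open>auto simp: g_def\<close>)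
  moreover have "relu_computable W (n + 2) (n + 1) 1 h"
  \<comment> \<open>One ReLU term suffices because
    \<open>max v w = v + max (w - v) 0\<close>.\<close>
  proof (rule relu_computable_shallow[where T = 1 and q = "\<lambda>t s. s $ (n + 1) - s $ n" and
      p = "\<lambda>i s. s $ i" and \<alpha> = "\<lambda>i t. if i < n then 0 else 1"])
    fix s :: "real vec" and i assume "s \<in> carrier_vec (n + 2)" "i < n + 1"
    then show "h s $ i = s $ i +
        (\<Sum>t<(1 :: nat). (if i < n then 0 else 1) * max (s $ (n + 1) - s $ n) 0)"
      by (auto simp: h_def less_Suc_eq max_def)
  next
    show "affine_fun (n + 2) (\<lambda>s. s $ (n + 1) - s $ n)"
      by (intro affine_fun_diff affine_fun_coord) auto
  qed (use assms in \<open>auto simp: h_def\<close>)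
  ultimately have "relu_computable W (n + 1) (n + 1) 2 (\<lambda>s. h (g s))"
    using relu_computable_comp[of W "n + 1" "n + 2" 1 g "n + 1" 1 h] by (simp add: numeral_2_eq_2)
  from relu_computable_comp[OF this Cons]
  have "relu_computable W (n + 1) (n + 1) (2 * length (y # ys)) (\<lambda>s. vec (n + 1)
    (\<lambda>i. if i < n then h (g s) $ i else lower_env e f ys (h (g s) $ n) (subvec p e (h (g s)))))"
    by simp
  then show ?case
  proof (rule relu_computable_cong)
    fix s :: "real vec" assume "s \<in> carrier_vec (n + 1)"
    have "subvec p e (h (g s)) = subvec p e s"
      using assms by (auto simp: subvec_def h_def g_def)
    then show "vec (n + 1) (\<lambda>i. if i < n then h (g s) $ i
        else lower_env e f ys (h (g s) $ n) (subvec p e (h (g s)))) =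
      vec (n + 1) (\<lambda>i. if i < n then s $ i else lower_env e f (y # ys) (s $ n) (subvec p e s))"
      by (auto simp: h_def g_def)
  qed
qed

subsection \<open>Approximation with additive errors\<close>

text \<open>
  The network is compared at an arbitrary \<open>x'\<close>, not only at points of \<open>X\<close>. This makes the errors of
  composed approximations add up although an approximate intermediate value may leave the domain
  of the next function. \<open>T\<close> counts elementary steps, each of which costs at most \<open>B\<close> hidden layers
  and adds at most \<open>\<delta>\<close> to the error.
\<close>

definition approximable ::
    "nat \<Rightarrow> real \<Rightarrow> real \<Rightarrow> nat \<Rightarrow> nat \<Rightarrow> nat \<Rightarrow> real vec set \<Rightarrow> (real vec \<Rightarrow> real vec) \<Rightarrow> bool" where
  "approximable W B \<delta> n m T X h \<longleftrightarrow>
    (\<exists>H F. real H \<le> real T * B \<and> relu_computable W n m H F \<and>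
      (\<forall>x \<in> X. \<forall>x' \<in> carrier_vec n. l1_dist m (F x') (h x) \<le> l1_dist n x' x + real T * \<delta>))"

lemma approximable_mono:
  assumes "approximable W B \<delta> n m T X h" "T \<le> T'" "0 \<le> B" "0 \<le> \<delta>" "Y \<subseteq> X"
    "\<And>x. x \<in> Y \<Longrightarrow> h x = h' x"
  shows "approximable W B \<delta> n m T' Y h'"
proof -
  from assms(1) obtain H F where F: "real H \<le> real T * B" "relu_computable W n m H F"
    "\<And>x x'. x \<in> X \<Longrightarrow> x' \<in> carrier_vec n \<Longrightarrow> l1_dist m (F x') (h x) \<le> l1_dist n x' x + real T * \<delta>"
    unfolding approximable_def by blast
  have "real T * B \<le> real T' * B" "real T * \<delta> \<le> real T' * \<delta>"
    using assms by (auto intro: mult_right_mono)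
  then have "real H \<le> real T' * B"
    "\<And>x x'. x \<in> Y \<Longrightarrow> x' \<in> carrier_vec n \<Longrightarrow> l1_dist m (F x') (h' x) \<le> l1_dist n x' x + real T' * \<delta>"
    using F(1,3) assms(5,6) by (force+)
  then show ?thesis unfolding approximable_def using F(2) by blast
qed

text \<open>The second estimate is applied at the exact value \<open>h\<^sub>1 x\<close>, which lies
  in \<open>Y\<close>, and at the network output \<open>F\<^sub>1 x'\<close>, which need not. Its
  distance term is what the first estimate bounds.\<close>

lemma approximable_comp:
  assumes "approximable W B \<delta> n k T\<^sub>1 X h\<^sub>1" "approximable W B \<delta> k m T\<^sub>2 Y h\<^sub>2"
    "\<And>x. x \<in> X \<Longrightarrow> h\<^sub>1 x \<in> Y"
  shows "approximable W B \<delta> n m (T\<^sub>1 + T\<^sub>2) X (\<lambda>x. h\<^sub>2 (h\<^sub>1 x))"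
proof -
  from assms(1) obtain H\<^sub>1 F\<^sub>1 where F\<^sub>1: "real H\<^sub>1 \<le> real T\<^sub>1 * B" "relu_computable W n k H\<^sub>1 F\<^sub>1"
    "\<And>x x'. x \<in> X \<Longrightarrow> x' \<in> carrier_vec n \<Longrightarrow>
      l1_dist k (F\<^sub>1 x') (h\<^sub>1 x) \<le> l1_dist n x' x + real T\<^sub>1 * \<delta>"
    unfolding approximable_def by blast
  from assms(2) obtain H\<^sub>2 F\<^sub>2 where F\<^sub>2: "real H\<^sub>2 \<le> real T\<^sub>2 * B" "relu_computable W k m H\<^sub>2 F\<^sub>2"
    "\<And>x x'. x \<in> Y \<Longrightarrow> x' \<in> carrier_vec k \<Longrightarrow>
      l1_dist m (F\<^sub>2 x') (h\<^sub>2 x) \<le> l1_dist k x' x + real T\<^sub>2 * \<delta>"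
    unfolding approximable_def by blast
  have "l1_dist m (F\<^sub>2 (F\<^sub>1 x')) (h\<^sub>2 (h\<^sub>1 x)) \<le> l1_dist n x' x + real (T\<^sub>1 + T\<^sub>2) * \<delta>"
    if "x \<in> X" "x' \<in> carrier_vec n" for x x'
    using F\<^sub>1(3)[OF that] F\<^sub>2(3)[OF assms(3)[OF that(1)] relu_computable_carrier[OF F\<^sub>1(2) that(2)]]
    by (simp add: algebra_simps)
  moreover have "real (H\<^sub>1 + H\<^sub>2) \<le> real (T\<^sub>1 + T\<^sub>2) * B"
    using F\<^sub>1(1) F\<^sub>2(1) by (simp add: algebra_simps)
  ultimately show ?thesis
    unfolding approximable_def using relu_computable_comp[OF F\<^sub>1(2) F\<^sub>2(2)] by blast
qed

lemma approximable_id: "approximable W B \<delta> n n 0 X (\<lambda>x. x)"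
  unfolding approximable_def
  by (intro exI[of _ 0] exI[of _ "\<lambda>x. x"]) (auto intro: relu_computable_affine)

section \<open>Replacing one block of coordinates by a single value\<close>

definition block_apply :: "nat \<Rightarrow> nat \<Rightarrow> nat \<Rightarrow> (real vec \<Rightarrow> real) \<Rightarrow> real vec \<Rightarrow> real vec" where
  "block_apply p e q f s = vec (p + 1 + q)
    (\<lambda>i. if i < p then s $ i else if i = p then f (subvec p e s) else s $ (i + e - 1))"

lemma block_apply_carrier [simp]: "block_apply p e q f s \<in> carrier_vec (p + 1 + q)"
  by (simp add: block_apply_def)

lemma sum_lessThan_add:
  fixes h :: "nat \<Rightarrow> 'a :: comm_monoid_add"
  shows "(\<Sum>i<m + n. h i) = (\<Sum>i<m. h i) + (\<Sum>i<n. h (m + i))"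
  by (induction n) (auto simp: add.assoc)

text \<open>The distance is a sum over three groups of coordinates. Those outside the block are at
  most shifted and contribute equally to both sides, so one replacement adds \<open>\<delta>\<close>
  only once, whatever the dimension.\<close>

lemma l1_dist_block_apply:
  assumes "\<bar>f' (subvec p e x') - f (subvec p e x)\<bar> \<le> l1_dist e (subvec p e x') (subvec p e x) + \<delta>"
  shows "l1_dist (p + 1 + q) (block_apply p e q f' x') (block_apply p e q f x)
    \<le> l1_dist (p + e + q) x' x + \<delta>"
proof -
  have "(\<Sum>j<e. \<bar>x' $ (p + j) - x $ (p + j)\<bar>) = l1_dist e (subvec p e x') (subvec p e x)"
    by (auto simp: l1_dist_def subvec_def)
  moreover have "l1_dist (p + 1 + q) (block_apply p e q f' x') (block_apply p e q f x) =
      (\<Sum>i<p. \<bar>x' $ i - x $ i\<bar>) + \<bar>f' (subvec p e x') - f (subvec p e x)\<bar> +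
      (\<Sum>i<q. \<bar>x' $ (p + e + i) - x $ (p + e + i)\<bar>)"
    unfolding l1_dist_def sum_lessThan_add by (simp add: block_apply_def add_ac)
  moreover have "l1_dist (p + e + q) x' x = (\<Sum>i<p. \<bar>x' $ i - x $ i\<bar>) +
      (\<Sum>j<e. \<bar>x' $ (p + j) - x $ (p + j)\<bar>) + (\<Sum>i<q. \<bar>x' $ (p + e + i) - x $ (p + e + i)\<bar>)"
    unfolding l1_dist_def sum_lessThan_add by simp
  ultimately show ?thesis using assms by linarith
qed

text \<open>Appending a register with value \<open>r\<close>, and finally moving it to position
  \<open>p\<close> while dropping the block, are affine maps. Only the running maximum costs hidden
  layers.\<close>

lemma relu_computable_block_apply_lower_env:
  assumes "1 \<le> e" "2 * (p + e + q) + 5 + e \<le> W"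
  shows "relu_computable W (p + e + q) (p + 1 + q) (2 * length ys)
    (block_apply p e q (lower_env e f ys r))"
proof -
  let ?n = "p + e + q"
  define g where "g s = vec (?n + 1) (\<lambda>i. if i < ?n then s $ i else r)" for s :: "real vec"
  define l where
    "l s = vec (?n + 1) (\<lambda>i. if i < ?n then s $ i else lower_env e f ys (s $ ?n) (subvec p e s))" for s
  define h where "h s = vec (p + 1 + q) (\<lambda>i. s $ (if i < p then i else if i = p then ?n else i + e - 1))"
    for s :: "real vec"
  have "relu_computable W ?n (?n + 1) 0 g"
    by (rule relu_computable_affine) (auto simp: g_def less_Suc_eq)
  moreover have "relu_computable W (?n + 1) (?n + 1) (2 * length ys) l"
    unfolding l_def using assms by (intro relu_computable_lower_env) auto
  moreover have "relu_computable W (?n + 1) (p + 1 + q) 0 h"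
    by (rule relu_computable_affine) (auto simp: h_def)
  ultimately have "relu_computable W ?n (p + 1 + q) (2 * length ys) (\<lambda>s. h (l (g s)))"
    using relu_computable_comp[of W ?n "?n + 1" 0 g "?n + 1" "2 * length ys" l]
      relu_computable_comp[of W ?n "?n + 1" "2 * length ys" "\<lambda>s. l (g s)" "p + 1 + q" 0 h] by simp
  then show ?thesis
  proof (rule relu_computable_cong)
    fix s :: "real vec"
    have "subvec p e (g s) = subvec p e s"
      by (auto simp: subvec_def g_def)
    then show "h (l (g s)) = block_apply p e q (lower_env e f ys r) s"
      using assms by (intro eq_vecI) (auto simp: block_apply_def h_def l_def g_def)
  qed
qed

text \<open>\<open>B\<close> is twice a bound for the number of grid points, as each point costs two
  hidden layers. The exponent \<open>m\<close> makes the bound uniform in the block length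
  \<open>e\<close>.\<close>

lemma approximable_block_apply:
  assumes lip: "\<And>x y. x \<in> cube e a b \<Longrightarrow> y \<in> cube e a b \<Longrightarrow> \<bar>f x - f y\<bar> \<le> l1_dist e x y"
    and e: "1 \<le> e" "e \<le> m" and ab: "a < b" "- u \<le> a" "b \<le> u" and u: "1 \<le> u"
    and \<delta>: "0 < \<delta>" "\<delta> \<le> 1" and W: "2 * (p + e + q) + 5 + e \<le> W"
    and B: "B = 2 * (6 * real m * u / \<delta>) ^ m"
  shows "approximable W B \<delta> (p + e + q) (p + 1 + q) 1 {x. subvec p e x \<in> cube e a b}
    (block_apply p e q f)"
proof -
  \<comment> \<open>The mesh makes the error \<open>2 * \<eta>\<close> of
    \<open>lower_env_approx\<close> at most \<open>\<delta>\<close>, with \<open>\<eta>\<close>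
    equal to \<open>e\<close> mesh widths.\<close>
  define N where "N = nat \<lceil>2 * real e * (b - a) / \<delta>\<rceil>"
  have pos: "0 < 2 * real e * (b - a) / \<delta>" using e ab \<delta> by simp
  then have N: "0 < N" "2 * real e * (b - a) / \<delta> \<le> real N" "real N \<le> 2 * real e * (b - a) / \<delta> + 1"
    unfolding N_def by linarith+
  have \<eta>: "2 * (real e * ((b - a) / real N)) \<le> \<delta>"
    using N(1,2) \<delta> by (simp add: field_simps)
  \<comment> \<open>This absorbs the additive 2, from rounding up and from \<open>N + 1\<close>,
    into the factor 6, and later allows the exponent \<open>e\<close> to be raised to
    \<open>m\<close>.\<close>
  have m1: "1 \<le> real m * u / \<delta>"
    using mult_mono[of 1 "real m" \<delta> u] e u \<delta> by simp
  have "2 * real e * (b - a) \<le> 2 * real m * (2 * u)"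
    using e ab u by (intro mult_mono) auto
  then have "2 * real e * (b - a) / \<delta> \<le> 4 * (real m * u / \<delta>)"
    using divide_right_mono[of _ _ \<delta>] \<delta> by fastforce
  then have "real (N + 1) \<le> 4 * (real m * u / \<delta>) + 2"
    using N(3) by simp
  also have "\<dots> \<le> 6 * (real m * u / \<delta>)"
    using add_left_mono[OF m1, of "2 * (real m * u / \<delta>)"] by argo
  also have "\<dots> = 6 * real m * u / \<delta>" by simp
  finally have "real (N + 1) \<le> 6 * real m * u / \<delta>" .
  then have "real (N + 1) ^ e \<le> (6 * real m * u / \<delta>) ^ e"
    by (intro power_mono) auto
  also have "\<dots> \<le> (6 * real m * u / \<delta>) ^ m"
    using m1 e by (intro power_increasing) auto
  finally have count: "real ((N + 1) ^ e) \<le> (6 * real m * u / \<delta>) ^ m" by simp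
  obtain ys where ys: "set ys \<subseteq> cube e a b" "length ys \<le> (N + 1) ^ e"
    "\<And>x. x \<in> cube e a b \<Longrightarrow> \<exists>y \<in> set ys. l1_dist e x y \<le> real e * ((b - a) / real N)"
    using cube_l1_net[OF ab(1) N(1), of e] by auto
  \<comment> \<open>The seed lies below \<open>f\<close> on the cube, because \<open>f\<close> is
    1-Lipschitz and no point is farther than \<open>e * (b - a)\<close> from the corner.\<close>
  define r where "r = f (vec e (\<lambda>_. a)) - real e * (b - a)"
  have r: "r \<le> f x" if "x \<in> cube e a b" for x
  proof -
    have "l1_dist e x (vec e (\<lambda>_. a)) \<le> (\<Sum>i<e. b - a)"
      unfolding l1_dist_def by (intro sum_mono) (use that in \<open>auto simp: cube_def\<close>)
    moreover have "vec e (\<lambda>_. a) \<in> cube e a b" using ab by (simp add: cube_def)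
    ultimately show ?thesis using lip[OF that, of "vec e (\<lambda>_. a)"] by (simp add: r_def)
  qed
  let ?F = "block_apply p e q (lower_env e f ys r)"
  have "relu_computable W (p + e + q) (p + 1 + q) (2 * length ys) ?F"
    by (intro relu_computable_block_apply_lower_env e W)
  moreover have "real (2 * length ys) \<le> real 1 * B"
    using ys(2) count unfolding B by (simp flip: of_nat_power of_nat_le_iff)
  moreover have "l1_dist (p + 1 + q) (?F x') (block_apply p e q f x) \<le> l1_dist (p + e + q) x' x + real 1 * \<delta>"
    if x: "subvec p e x \<in> cube e a b" for x x'
  proof -
    obtain y where "y \<in> set ys" "l1_dist e (subvec p e x) y \<le> real e * ((b - a) / real N)"
      using ys(3)[OF x] by blast
    then have "\<bar>lower_env e f ys r (subvec p e x') - f (subvec p e x)\<bar> \<le>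
        l1_dist e (subvec p e x') (subvec p e x) + 2 * (real e * ((b - a) / real N))"
      using lower_env_approx[OF lip ys(1) x r[OF x]] by blast
    with \<eta> show ?thesis by (intro l1_dist_block_apply) simp
  qed
  ultimately show ?thesis unfolding approximable_def by blast
qed

section \<open>Functions acting on consecutive blocks\<close>

text \<open>
  Blocks are processed from left to right, so the first \<open>p\<close> coordinates already hold outputs, about
  which nothing is required.
\<close>

definition tail_box :: "nat \<Rightarrow> nat \<Rightarrow> real \<Rightarrow> real \<Rightarrow> real vec set" where
  "tail_box p n a b = {x \<in> carrier_vec n. \<forall>i. p \<le> i \<and> i < n \<longrightarrow> a \<le> x $ i \<and> x $ i \<le> b}"

lemma subvec_tail_box:
  "x \<in> tail_box p n a b \<Longrightarrow> p + e \<le> n \<Longrightarrow> subvec p e x \<in> cube e a b"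
  by (auto simp: tail_box_def cube_def subvec_def)

text \<open>A block of length \<open>e\<close> is charged \<open>e\<close> steps, so that the total
  is the dimension being processed. Once the first block is replaced, its value joins the finished
  coordinates and \<open>p + 1\<close> takes the role of \<open>p\<close>. By
  \<open>1 \<le> e\<close> the intermediate dimensions never exceed \<open>u\<close>.\<close>

lemma approximable_parallel:
  assumes "\<And>e f p q. (e, f) \<in> set fs \<Longrightarrow> p + e + q \<le> u \<Longrightarrow>
      approximable W B \<delta> (p + e + q) (p + 1 + q) e (tail_box p (p + e + q) a b) (block_apply p e q f)"
    and "p + sum_list (map fst fs) \<le> u" "\<And>e f. (e, f) \<in> set fs \<Longrightarrow> 1 \<le> e"
    and "0 \<le> B" "0 \<le> \<delta>"
  shows "approximable W B \<delta> (p + sum_list (map fst fs)) (p + length fs) (sum_list (map fst fs))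
    (tail_box p (p + sum_list (map fst fs)) a b)
    (\<lambda>x. vec_first x p @\<^sub>v
      parallel (map (\<lambda>(e, h). (e, scalar_fun h)) fs) (vec_last x (sum_list (map fst fs))))"
  using assms
proof (induction fs arbitrary: p)
  case Nil
  have nil: "vec_first x p @\<^sub>v vNil = x" if "x \<in> carrier_vec p" for x :: "real vec"
    using that by (intro eq_vecI) (auto simp: vec_first_def)
  have "approximable W B \<delta> p p 0 (tail_box p p a b) (\<lambda>x. vec_first x p @\<^sub>v vNil)"
    by (rule approximable_mono[OF approximable_id order_refl])
      (use Nil in \<open>auto simp: tail_box_def nil\<close>)
  then show ?case by simp
next
  case (Cons ef fs)
  obtain e f where ef: "ef = (e, f)" by force
  define q where "q = sum_list (map fst fs)"
  let ?par = "parallel (map (\<lambda>(e, h). (e, scalar_fun h)) fs)"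
  have e: "1 \<le> e" using Cons.prems(3) ef by auto
  have 1: "approximable W B \<delta> (p + e + q) (p + 1 + q) e (tail_box p (p + e + q) a b) (block_apply p e q f)"
    using Cons.prems(1,2) ef by (auto simp: q_def)
  have 2: "approximable W B \<delta> (p + 1 + q) (p + 1 + length fs) q (tail_box (p + 1) (p + 1 + q) a b)
    (\<lambda>x. vec_first x (p + 1) @\<^sub>v ?par (vec_last x q))"
    unfolding q_def
  proof (rule Cons.IH)
    show "1 \<le> e" if "(e, f) \<in> set fs" for e f
      using Cons.prems(3)[of e f] that by simp
  qed (use Cons.prems e ef in auto)
  \<comment> \<open>Coordinates after the replaced block keep their values, so the remaining blocks
    still receive arguments in \<open>[a, b]\<close>.\<close>
  have box: "block_apply p e q f x \<in> tail_box (p + 1) (p + 1 + q) a b"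
    if "x \<in> tail_box p (p + e + q) a b" for x
  proof -
    have "a \<le> x $ (i + e - 1) \<and> x $ (i + e - 1) \<le> b" if "p + 1 \<le> i" "i < p + 1 + q" for i
      using \<open>x \<in> _\<close> that e unfolding tail_box_def by (auto dest!: spec[of _ "i + e - 1"])
    then show ?thesis by (auto simp: tail_box_def block_apply_def)
  qed
  \<comment> \<open>The new value passes from the head of the parallel output to the end of the
    finished prefix; this is associativity of concatenation.\<close>
  have eq: "vec_first (block_apply p e q f x) (p + 1) @\<^sub>v ?par (vec_last (block_apply p e q f x) q) =
    vec_first x p @\<^sub>v parallel ((e, scalar_fun f) # map (\<lambda>(e, h). (e, scalar_fun h)) fs) (vec_last x (e + q))"
    if "x \<in> tail_box p (p + e + q) a b" for x
  proof -
    have x: "x \<in> carrier_vec (p + e + q)" using that by (simp add: tail_box_def)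
    have "vec_last (block_apply p e q f x) q = vec_last (vec_last x (e + q)) q"
      using x e by (intro eq_vecI) (auto simp: vec_last_def block_apply_def add_ac)
    moreover have "vec_first (vec_last x (e + q)) e = subvec p e x"
      using x by (intro eq_vecI) (auto simp: vec_last_def vec_first_def subvec_def)
    moreover have "vec_first (block_apply p e q f x) (p + 1) = vec_first x p @\<^sub>v scalar_fun f (subvec p e x)"
      using x by (intro eq_vecI) (auto simp: vec_first_def block_apply_def scalar_fun_def)
    moreover have "(u @\<^sub>v v) @\<^sub>v w = u @\<^sub>v (v @\<^sub>v w)" for u v w :: "real vec"
      by (intro eq_vecI) auto
    ultimately show ?thesis by simp
  qed
  from approximable_mono[OF approximable_comp[OF 1 2 box] order_refl Cons.prems(4,5) order_refl eq]
  show ?case by (simp add: ef q_def add_ac)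
qed

section \<open>Iterated binary operations: maxima and products\<close>

lemma approximable_block_apply_iterate:
  assumes bin: "\<And>p q. p + 2 + q \<le> u \<Longrightarrow> approximable W B \<delta> (p + 2 + q) (p + 1 + q) 1
      (tail_box p (p + 2 + q) a b) (block_apply p 2 q (\<lambda>z. op (z $ 0) (z $ 1)))"
    and closed: "\<And>x y. a \<le> x \<Longrightarrow> x \<le> b \<Longrightarrow> a \<le> y \<Longrightarrow> y \<le> b \<Longrightarrow> a \<le> op x y \<and> op x y \<le> b"
    and f1: "\<And>z. z \<in> carrier_vec 1 \<Longrightarrow> f z = z $ 0"
    and f2: "\<And>z n. z \<in> carrier_vec (n + 2) \<Longrightarrow>
      f z = f (block_apply 0 2 n (\<lambda>w. op (w $ 0) (w $ 1)) z)"
    and "0 \<le> B" "0 \<le> \<delta>" and "p + Suc n + q \<le> u"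
  shows "approximable W B \<delta> (p + Suc n + q) (p + 1 + q) (Suc n) (tail_box p (p + Suc n + q) a b)
    (block_apply p (Suc n) q f)"
  using assms(7)
proof (induction n)
  case 0
  \<comment> \<open>A block of length 1 is left alone; the step charged for it is slack that makes
    the count equal to the block length.\<close>
  have "x = block_apply p 1 q f x" if "x \<in> carrier_vec (p + 1 + q)" for x
    using that by (intro eq_vecI) (auto simp: block_apply_def f1 subvec_def)
  then have "approximable W B \<delta> (p + 1 + q) (p + 1 + q) 1 (tail_box p (p + 1 + q) a b) (block_apply p 1 q f)"
    by (intro approximable_mono[OF approximable_id]) (use assms in \<open>auto simp: tail_box_def\<close>)
  then show ?case by simp
next
  case (Suc n)
  let ?op = "\<lambda>z :: real vec. op (z $ 0) (z $ 1)"
  \<comment> \<open>The first two entries of the block are merged. \<open>closed\<close> keeps the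
    result in \<open>[a, b]\<close>, so that the induction hypothesis applies to the shorter block,
    and by \<open>f2\<close> the value of \<open>f\<close> is preserved.\<close>
  have 1: "approximable W B \<delta> (p + 2 + (n + q)) (p + 1 + (n + q)) 1
      (tail_box p (p + 2 + (n + q)) a b) (block_apply p 2 (n + q) ?op)"
    using Suc.prems by (intro bin) simp
  have 2: "approximable W B \<delta> (p + 1 + (n + q)) (p + 1 + q) (Suc n) (tail_box p (p + 1 + (n + q)) a b)
      (block_apply p (Suc n) q f)"
    using Suc by (simp add: add.assoc)
  have box: "block_apply p 2 (n + q) ?op x \<in> tail_box p (p + 1 + (n + q)) a b"
    if "x \<in> tail_box p (p + 2 + (n + q)) a b" for x
    using that by (auto simp: tail_box_def block_apply_def subvec_def intro!: closed[THEN conjunct1] closed[THEN conjunct2])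
  have eq: "block_apply p (Suc n) q f (block_apply p 2 (n + q) ?op x) = block_apply p (Suc (Suc n)) q f x"
    for x
  proof -
    have "subvec p (Suc n) (block_apply p 2 (n + q) ?op x) = block_apply 0 2 n ?op (subvec p (n + 2) x)"
      by (intro eq_vecI) (auto simp: subvec_def block_apply_def)
    then have "f (subvec p (Suc n) (block_apply p 2 (n + q) ?op x)) = f (subvec p (Suc (Suc n)) x)"
      using f2[of "subvec p (n + 2) x" n] by simp
    then show ?thesis
      by (intro eq_vecI) (auto simp: block_apply_def[of p "Suc n"] block_apply_def[of p "Suc (Suc n)"],
        auto simp: block_apply_def)
  qed
  from approximable_mono[OF approximable_comp[OF 1 2 box] order_refl assms(5,6) order_refl eq]
  show ?case by (simp add: add_ac numeral_2_eq_2)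
qed

lemma block_apply_0_2:
  "block_apply 0 2 n h z = vec (n + 1) (\<lambda>i. if i = 0 then h (subvec 0 2 z) else z $ (i + 1))"
  by (intro eq_vecI) (auto simp: block_apply_def)

lemma image_lessThan_Suc: "h ` {..<Suc n} = insert (h 0) ((\<lambda>i. h (Suc i)) ` {..<n})"
  by (simp add: lessThan_Suc_eq_insert_0 image_image)

lemma max_coord_merge:
  assumes "z \<in> carrier_vec (n + 2)"
  shows "max_coord z = max_coord (block_apply 0 2 n (\<lambda>w. max (w $ 0) (w $ 1)) z)"
proof -
  define v where "v = block_apply 0 2 n (\<lambda>w. max (w $ 0) (w $ 1)) z"
  define S where "S = (\<lambda>i. z $ Suc (Suc i)) ` {..<n}"
  have v: "dim_vec v = Suc n" "v $ 0 = max (z $ 0) (z $ 1)" "\<And>i. i < n \<Longrightarrow> v $ Suc i = z $ Suc (Suc i)"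
    by (simp_all add: v_def block_apply_0_2 subvec_def)
  have "(\<lambda>i. v $ Suc i) ` {..<n} = S"
    unfolding S_def by (intro image_cong) (auto simp: v)
  then have "max_coord v = Max (insert (max (z $ 0) (z $ 1)) S)"
    by (simp add: max_coord_def v(1,2) image_lessThan_Suc)
  moreover have "max_coord z = Max (insert (z $ 0) (insert (z $ 1) S))"
    using assms by (simp add: max_coord_def image_lessThan_Suc S_def)
  moreover have "finite S" by (simp add: S_def)
  \<comment> \<open>An empty tail is treated separately because the recursion for \<open>Max\<close>
    needs a non-empty set.\<close>
  ultimately show ?thesis
    unfolding v_def[symmetric] by (cases "S = {}") (simp_all add: max.assoc)
qed

lemma prod_coord_merge:
  assumes "z \<in> carrier_vec (n + 2)"
  shows "prod_coord z = prod_coord (block_apply 0 2 n (\<lambda>w. w $ 0 * w $ 1) z)"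
  using assms
  by (simp add: prod_coord_def block_apply_0_2 subvec_def prod.lessThan_Suc_shift del: prod.lessThan_Suc)

text \<open>Changing one factor at a time leaves a multiplier of absolute value at most 1 in each
  difference. This makes multiplication 1-Lipschitz on the box where products are formed.\<close>

lemma abs_mult_diff_le:
  fixes x x' y y' :: real
  assumes "\<bar>x'\<bar> \<le> 1" "\<bar>y\<bar> \<le> 1"
  shows "\<bar>x * y - x' * y'\<bar> \<le> \<bar>x - x'\<bar> + \<bar>y - y'\<bar>"
proof -
  have "x * y - x' * y' = (x - x') * y + x' * (y - y')" by (simp add: algebra_simps)
  moreover have "\<bar>(x - x') * y\<bar> \<le> \<bar>x - x'\<bar>" "\<bar>x' * (y - y')\<bar> \<le> \<bar>y - y'\<bar>"
    using assms by (auto simp: abs_mult mult_left_le mult_left_le_one_le)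
  ultimately show ?thesis by linarith
qed

subsection \<open>The three function classes\<close>

lemma approximable_parallel_cube:
  assumes "\<And>e f p q. (e, f) \<in> set fs \<Longrightarrow> p + e + q \<le> u \<Longrightarrow>
      approximable W B \<delta> (p + e + q) (p + 1 + q) e (tail_box p (p + e + q) a b) (block_apply p e q f)"
    and "sum_list (map fst fs) = n" "n \<le> u" "\<And>e f. (e, f) \<in> set fs \<Longrightarrow> 1 \<le> e"
    and "0 \<le> B" "0 \<le> \<delta>"
  shows "approximable W B \<delta> n (length fs) u (cube n a b)
    (parallel (map (\<lambda>(e, h). (e, scalar_fun h)) fs))"
proof -
  have "approximable W B \<delta> (0 + n) (0 + length fs) n (tail_box 0 (0 + n) a b)
    (\<lambda>x. vec_first x 0 @\<^sub>v parallel (map (\<lambda>(e, h). (e, scalar_fun h)) fs) (vec_last x n))"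
    using approximable_parallel[of fs u W B \<delta> a b 0] assms by simp
  from approximable_mono[OF this \<open>n \<le> u\<close> assms(5,6)] have "approximable W B \<delta> (0 + n) (0 + length fs) u (cube n a b)
    (parallel (map (\<lambda>(e, h). (e, scalar_fun h)) fs))"
  proof this
    show "cube n a b \<subseteq> tail_box 0 (0 + n) a b" by (auto simp: cube_def tail_box_def)
    fix x assume "x \<in> cube n a b"
    then have "vec_last x n = x" by (intro eq_vecI) (auto simp: cube_def vec_last_def)
    moreover have "vec_first x 0 @\<^sub>v y = y" for y by (intro eq_vecI) auto
    ultimately show "vec_first x 0 @\<^sub>v parallel (map (\<lambda>(e, h). (e, scalar_fun h)) fs) (vec_last x n) =
      parallel (map (\<lambda>(e, h). (e, scalar_fun h)) fs) x" by simp
  qed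
  then show ?thesis by simp
qed

lemma dim_parallel_scalar:
  "dim_vec (parallel (map (\<lambda>(e, h). (e, scalar_fun h)) fs) x) = length fs"
  by (induction fs arbitrary: x) (auto simp: scalar_fun_def)

lemma const_vec_cube: "a \<le> t \<Longrightarrow> t \<le> b \<Longrightarrow> vec n (\<lambda>_. t) \<in> cube n a b"
  by (simp add: cube_def)

text \<open>The function classes only assert that some \<open>d\<close>, \<open>a\<close>,
  \<open>b\<close> describe \<open>Q\<close>; this ties them to the given dimension and bounds.
  Constant vectors test both ends, and \<open>1 \<le> n\<close> provides a coordinate at which to
  read them.\<close>

lemma cube_subset_cubeD:
  assumes "cube d a b \<subseteq> cube n l r" "a < b" "1 \<le> n"
  shows "d = n \<and> l \<le> a \<and> b \<le> r"
proof -
  have "vec d (\<lambda>_. a) \<in> cube n l r" "vec d (\<lambda>_. b) \<in> cube n l r"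
    using assms const_vec_cube[of a a b d] const_vec_cube[of a b b d] by auto
  then show ?thesis using assms(3) by (fastforce simp: cube_def)
qed

text \<open>The binary maximum is 1-Lipschitz for \<open>l1_dist\<close> and maps every interval
  into itself, so it can be iterated. \<open>2 \<le> m\<close> admits blocks of two
  coordinates.\<close>

lemma approximable_max_blocks:
  assumes "a < b" "- real u \<le> a" "b \<le> real u" "1 \<le> u" "2 \<le> m" "0 < \<delta>" "\<delta> \<le> 1"
    and "2 * u + 5 + m \<le> W" "B = 2 * (6 * real m * real u / \<delta>) ^ m"
    and "1 \<le> e" "p + e + q \<le> u"
  shows "approximable W B \<delta> (p + e + q) (p + 1 + q) e (tail_box p (p + e + q) a b)
    (block_apply p e q max_coord)"
proof -
  have B: "0 \<le> B" using assms by simp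
  have bin: "approximable W B \<delta> (p + 2 + q) (p + 1 + q) 1 (tail_box p (p + 2 + q) a b)
      (block_apply p 2 q (\<lambda>z. max (z $ 0) (z $ 1)))" if "p + 2 + q \<le> u" for p q
  proof (rule approximable_mono[OF approximable_block_apply[where m = m and u = "real u"]])
    show "\<bar>max (x $ 0) (x $ 1) - max (y $ 0) (y $ 1)\<bar> \<le> l1_dist 2 x y" for x y
      by (auto simp: l1_dist_def numeral_2_eq_2 max_def)
    show "tail_box p (p + 2 + q) a b \<subseteq> {x. subvec p 2 x \<in> cube 2 a b}"
      using subvec_tail_box[of _ p "p + 2 + q" a b 2] by auto
  qed (use assms that B in auto)
  obtain e' where e': "e = Suc e'" using assms(10) by (cases e) auto
  show ?thesis
    unfolding e'
  proof (rule approximable_block_apply_iterate[where op = max, OF bin])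
    show "max_coord z = z $ 0" if "z \<in> carrier_vec 1" for z
      using that by (simp add: max_coord_def lessThan_Suc)
  qed (use assms e' B max_coord_merge in auto)
qed

text \<open>On the interval from -1/8 to 1/8 multiplication is 1-Lipschitz and does not leave the
  interval; iteration needs both.\<close>

lemma approximable_prod_blocks:
  assumes "1 \<le> u" "2 \<le> m" "0 < \<delta>" "\<delta> \<le> 1"
    and "2 * u + 5 + m \<le> W" "B = 2 * (6 * real m * real u / \<delta>) ^ m"
    and "1 \<le> e" "p + e + q \<le> u"
  shows "approximable W B \<delta> (p + e + q) (p + 1 + q) e (tail_box p (p + e + q) (- 1 / 8) (1 / 8))
    (block_apply p e q prod_coord)"
proof -
  have B: "0 \<le> B" using assms by simp
  have bin: "approximable W B \<delta> (p + 2 + q) (p + 1 + q) 1 (tail_box p (p + 2 + q) (- 1 / 8) (1 / 8))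
      (block_apply p 2 q (\<lambda>z. z $ 0 * z $ 1))" if "p + 2 + q \<le> u" for p q
  proof (rule approximable_mono[OF approximable_block_apply[where m = m and u = "real u"
        and a = "- 1 / 8" and b = "1 / 8"]])
    show "\<bar>x $ 0 * x $ 1 - y $ 0 * y $ 1\<bar> \<le> l1_dist 2 x y"
      if "x \<in> cube 2 (- 1 / 8) (1 / 8)" "y \<in> cube 2 (- 1 / 8) (1 / 8)" for x y
    proof -
      have "- 1 / 8 \<le> y $ 0" "y $ 0 \<le> 1 / 8" "- 1 / 8 \<le> x $ 1" "x $ 1 \<le> 1 / 8"
        using that by (auto simp: cube_def)
      then show ?thesis
        using abs_mult_diff_le[of "y $ 0" "x $ 1" "x $ 0" "y $ 1"]
        by (simp add: l1_dist_def numeral_2_eq_2 abs_le_iff)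
    qed
    show "tail_box p (p + 2 + q) (- 1 / 8) (1 / 8) \<subseteq> {x. subvec p 2 x \<in> cube 2 (- 1 / 8) (1 / 8)}"
      using subvec_tail_box[of _ p "p + 2 + q" "- 1 / 8" "1 / 8" 2] by auto
  qed (use assms that B in auto)
  have closed: "- 1 / 8 \<le> x * y \<and> x * y \<le> 1 / 8"
    if "- 1 / 8 \<le> x" "x \<le> 1 / 8" "- 1 / 8 \<le> y" "y \<le> 1 / 8" for x y :: real
  proof -
    have "\<bar>x\<bar> * \<bar>y\<bar> \<le> 1 / 8 * 1" using that by (intro mult_mono) auto
    then have "\<bar>x * y\<bar> \<le> 1 / 8" by (simp add: abs_mult)
    then show ?thesis by linarith
  qed
  obtain e' where e': "e = Suc e'" using assms(7) by (cases e) auto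
  show ?thesis
    unfolding e'
  proof (rule approximable_block_apply_iterate[where op = "(*)", OF bin closed])
    show "prod_coord z = z $ 0" if "z \<in> carrier_vec 1" for z
      using that by (simp add: prod_coord_def)
  qed (use assms e' B prod_coord_merge in auto)
qed

lemma approximable_class:
  assumes n: "1 \<le> n" "n \<le> u" and Q: "Q \<subseteq> cube n (- real u) (real u)"
    and cont: "g \<in> cont_funs n Q n'"
    and cls: "g \<in> lipschitz_class c 1 Q 1 \<union> max_class Q \<union> prod_class Q"
    and prd: "g \<in> prod_class Q \<Longrightarrow> Q \<subseteq> cube n (- 1 / 8) (1 / 8)"
    and m: "c \<le> m" "2 \<le> m" and \<delta>: "0 < \<delta>" "\<delta> \<le> 1"
    and W: "2 * u + 5 + m \<le> W" and B: "B = 2 * (6 * real m * real u / \<delta>) ^ m"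
  shows "approximable W B \<delta> n n' u Q g"
proof -
  have B0: "0 \<le> B" using \<delta> B by simp
  have u: "1 \<le> u" using n by simp
  \<comment> \<open>\<open>max_class\<close> and \<open>prod_class\<close> do not mention the
    codomain. The number of blocks is compared with \<open>n'\<close> by evaluating \<open>g\<close>
    at a corner of the cube.\<close>
  have len: "length fs = n'" if "Q = cube n a b" "a < b"
    "\<And>x. x \<in> Q \<Longrightarrow> g x = parallel (map (\<lambda>(e, h). (e, scalar_fun h)) fs) x" for a b fs
  proof -
    have x: "vec n (\<lambda>_. a) \<in> Q" using that const_vec_cube by simp
    moreover have "Q \<subseteq> carrier_vec n" using that by (auto simp: cube_def)
    ultimately have "g (vec n (\<lambda>_. a)) \<in> carrier_vec n'" using cont_funs_carrier[OF cont] by blast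
    then show ?thesis using that(3)[OF x] dim_parallel_scalar by (metis carrier_vecD)
  qed
  from cls consider "g \<in> lipschitz_class c 1 Q 1" | "g \<in> max_class Q" | "g \<in> prod_class Q" by blast
  then show ?thesis
  proof cases
    case 1
    then obtain d a b fs where ab: "a < b" "Q = cube d a b"
      and fs: "\<And>e h. (e, h) \<in> set fs \<Longrightarrow> 1 \<le> e \<and> e \<le> c \<and>
          (\<forall>x \<in> cube e a b. \<forall>y \<in> cube e a b. \<bar>h x - h y\<bar> \<le> 1 * lp_norm 1 (x - y))"
        "sum_list (map fst fs) = d"
        "\<And>x. x \<in> Q \<Longrightarrow> g x = parallel (map (\<lambda>(e, h). (e, scalar_fun h)) fs) x"
      unfolding lipschitz_class_def by fast
    have d: "d = n" "- real u \<le> a" "b \<le> real u"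
      using cube_subset_cubeD[of d a b n] Q ab n by auto
    have el: "approximable W B \<delta> (p + e + q) (p + 1 + q) e (tail_box p (p + e + q) a b) (block_apply p e q f)"
      if "(e, f) \<in> set fs" "p + e + q \<le> u" for e f p q
    proof (rule approximable_mono[OF approximable_block_apply[where m = m and u = "real u"]])
      show "\<bar>f x - f y\<bar> \<le> l1_dist e x y" if "x \<in> cube e a b" "y \<in> cube e a b" for x y
      proof -
        have "\<bar>f x - f y\<bar> \<le> 1 * lp_norm 1 (x - y)"
          using fs(1)[OF \<open>(e, f) \<in> set fs\<close>] that by blast
        then show ?thesis using that lp_norm_1_diff[of x e y] by (simp add: cube_def)
      qed
      show "tail_box p (p + e + q) a b \<subseteq> {x. subvec p e x \<in> cube e a b}"
        using subvec_tail_box[of _ p "p + e + q" a b e] by auto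
    qed (use fs(1)[OF that(1)] that(2) ab d m \<delta> W B B0 u in auto)
    have *: "approximable W B \<delta> n (length fs) u (cube n a b) (parallel (map (\<lambda>(e, h). (e, scalar_fun h)) fs))"
      using fs d n B0 \<delta> by (intro approximable_parallel_cube el) auto
    have eq: "g x = parallel (map (\<lambda>(e, h). (e, scalar_fun h)) fs) x" if "x \<in> Q" for x
      using fs(3)[OF that] by simp
    have len: "length fs = n'"
      using ab d eq by (intro len[of a b]) simp_all
    have sub: "Q \<subseteq> cube n a b" using ab d by simp
    show ?thesis
      by (rule approximable_mono[OF *[unfolded len] order_refl B0 less_imp_le[OF \<delta>(1)] sub eq[symmetric]])
  next
    case 2
    then obtain d a b ds where ab: "a < b" "Q = cube d a b"
      and ds: "\<forall>e \<in> set ds. 1 \<le> e" "sum_list ds = d"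
        "\<And>x. x \<in> Q \<Longrightarrow> g x = parallel (map (\<lambda>e. (e, scalar_fun max_coord)) ds) x"
      unfolding max_class_def by fast
    define fs where "fs = map (\<lambda>e. (e, max_coord)) ds"
    have fs: "map (\<lambda>(e, h). (e, scalar_fun h)) fs = map (\<lambda>e. (e, scalar_fun max_coord)) ds"
      "sum_list (map fst fs) = d"
      using ds by (simp_all add: fs_def o_def)
    have d: "d = n" "- real u \<le> a" "b \<le> real u"
      using cube_subset_cubeD[of d a b n] Q ab n by auto
    have *: "approximable W B \<delta> n (length fs) u (cube n a b) (parallel (map (\<lambda>(e, h). (e, scalar_fun h)) fs))"
    proof (rule approximable_parallel_cube)
      show "approximable W B \<delta> (p + e + q) (p + 1 + q) e (tail_box p (p + e + q) a b) (block_apply p e q f)"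
        if "(e, f) \<in> set fs" "p + e + q \<le> u" for e f p q
        using that ds ab d m \<delta> W B u approximable_max_blocks[of a b u m \<delta> W B e p q]
        by (auto simp: fs_def)
    qed (use fs ds d n B0 \<delta> in \<open>auto simp: fs_def\<close>)
    have eq: "g x = parallel (map (\<lambda>(e, h). (e, scalar_fun h)) fs) x" if "x \<in> Q" for x
      using ds(3)[OF that] fs(1) by simp
    have len: "length fs = n'"
      using ab d eq by (intro len[of a b]) simp_all
    have sub: "Q \<subseteq> cube n a b" using ab d by simp
    show ?thesis
      by (rule approximable_mono[OF *[unfolded len] order_refl B0 less_imp_le[OF \<delta>(1)] sub eq[symmetric]])
  next
    case 3
    then obtain d a b ds where ab: "a < b" "Q = cube d a b"
      and ds: "\<forall>e \<in> set ds. 1 \<le> e" "sum_list ds = d"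
        "\<And>x. x \<in> Q \<Longrightarrow> g x = parallel (map (\<lambda>e. (e, scalar_fun prod_coord)) ds) x"
      unfolding prod_class_def by fast
    define fs where "fs = map (\<lambda>e. (e, prod_coord)) ds"
    have fs: "map (\<lambda>(e, h). (e, scalar_fun h)) fs = map (\<lambda>e. (e, scalar_fun prod_coord)) ds"
      "sum_list (map fst fs) = d"
      using ds by (simp_all add: fs_def o_def)
    have d: "d = n" using cube_subset_cubeD[of d a b n] Q ab n by auto
    \<comment> \<open>The network is built for the symmetric box and then restricted to
      \<open>Q\<close>, because \<open>[a, b]\<close> itself need not be closed under
      multiplication.\<close>
    have *: "approximable W B \<delta> n (length fs) u (cube n (- 1 / 8) (1 / 8))
      (parallel (map (\<lambda>(e, h). (e, scalar_fun h)) fs))"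
    proof (rule approximable_parallel_cube)
      show "approximable W B \<delta> (p + e + q) (p + 1 + q) e (tail_box p (p + e + q) (- 1 / 8) (1 / 8))
          (block_apply p e q f)"
        if "(e, f) \<in> set fs" "p + e + q \<le> u" for e f p q
        using that ds m \<delta> W B u approximable_prod_blocks[of u m \<delta> W B e p q]
        by (auto simp: fs_def)
    qed (use fs ds d n B0 \<delta> in \<open>auto simp: fs_def\<close>)
    have eq: "g x = parallel (map (\<lambda>(e, h). (e, scalar_fun h)) fs) x" if "x \<in> Q" for x
      using ds(3)[OF that] fs(1) by simp
    have len: "length fs = n'"
      using ab d eq by (intro len[of a b]) simp_all
    have sub: "Q \<subseteq> cube n (- 1 / 8) (1 / 8)" using prd[OF 3] by simp
    show ?thesis
      by (rule approximable_mono[OF *[unfolded len] order_refl B0 less_imp_le[OF \<delta>(1)] sub eq[symmetric]])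
  qed
qed

section \<open>The composition of all functions\<close>

lemma approximable_fold:
  assumes "\<And>i. i \<in> {1..k} \<Longrightarrow> approximable W B \<delta> (n i) (n (i + 1)) u (Q i) (g i)"
    and "\<And>i. i \<in> {1..k - 1} \<Longrightarrow> g i ` Q i \<subseteq> Q (i + 1)"
  shows "j \<le> k \<Longrightarrow> approximable W B \<delta> (n 1) (n (j + 1)) (j * u) (Q 1) (fold g [1..<j + 1]) \<and>
    (j < k \<longrightarrow> (\<forall>x \<in> Q 1. fold g [1..<j + 1] x \<in> Q (j + 1)))"
proof (induction j)
  case 0
  have "fold g [1..<0 + 1] = (\<lambda>x. x)" by (simp add: fun_eq_iff)
  then show ?case using approximable_id by simp
next
  case (Suc j)
  have fold: "fold g [1..<Suc j + 1] = (\<lambda>x. g (j + 1) (fold g [1..<j + 1] x))"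
    by (simp add: fun_eq_iff)
  have "approximable W B \<delta> (n (j + 1)) (n (j + 1 + 1)) u (Q (j + 1)) (g (j + 1))"
    using Suc.prems by (intro assms(1)) auto
  from approximable_comp[OF _ this, of "n 1" "j * u" "Q 1" "fold g [1..<j + 1]"]
  have "approximable W B \<delta> (n 1) (n (Suc j + 1)) (Suc j * u) (Q 1) (fold g [1..<Suc j + 1])"
    using Suc unfolding fold by (simp add: add.commute)
  \<comment> \<open>Membership in the next cube is needed only while another function follows; the
    last output is not confined to any cube.\<close>
  moreover have "fold g [1..<Suc j + 1] x \<in> Q (Suc j + 1)" if "Suc j < k" "x \<in> Q 1" for x
    using Suc assms(2)[of "j + 1"] that unfolding fold by fastforce
  ultimately show ?case by blast
qed

subsection \<open>Counting parameters\<close>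

text \<open>There are at most \<open>u ^ 2\<close> steps, the squared width is of order
  \<open>c\<^sup>2 * u ^ 2\<close>, and precision \<open>\<epsilon> / u ^ 2\<close> puts
  \<open>(u ^ 3 / \<epsilon>) ^ (2 * c)\<close> into the grid count. This explains the exponent
  \<open>6 * c + 4\<close>.\<close>

lemma param_bound:
  fixes c u H W P :: nat and \<epsilon> :: real
  assumes "1 \<le> c" "1 \<le> u" "0 < \<epsilon>" "\<epsilon> \<le> 1"
    and H: "real H \<le> real (u * u) * (2 * (6 * real (2 * c) * real u / (\<epsilon> / real (u * u))) ^ (2 * c))"
    and W: "W = 2 * u + 5 + 2 * c" and P: "P \<le> (H + 1) * (W * (W + 1))"
  shows "real P \<le> real (270 * c\<^sup>2 * (12 * c) ^ (2 * c)) * real u ^ (6 * c + 4) * \<epsilon> powr (- 2 * real c)"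
proof -
  define M where "M = (12 * real c * real u ^ 3 / \<epsilon>) ^ (2 * c)"
  have M: "6 * real (2 * c) * real u / (\<epsilon> / real (u * u)) = 12 * real c * real u ^ 3 / \<epsilon>"
    by (simp add: power3_eq_cube mult_ac)
  have H: "real H \<le> real u ^ 2 * (2 * M)"
    using H unfolding M M_def[symmetric] by (simp add: power2_eq_square)
  have c3: "1 \<le> real c * real u ^ 3" using assms mult_mono[of 1 "real c" 1 "real u ^ 3"] by simp
  then have "\<epsilon> \<le> 12 * (real c * real u ^ 3)" using assms by linarith
  \<comment> \<open>With this the summand 1 in \<open>H + 1\<close> is absorbed, which turns the
    factor 2 into 3.\<close>
  then have "1 \<le> M" unfolding M_def using assms by (intro one_le_power) simp
  moreover have "1 \<le> real u ^ 2" using assms by simp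
  ultimately have "1 \<le> real u ^ 2 * M" using mult_mono[of 1 "real u ^ 2" 1 M] by simp
  with H have H1: "real (H + 1) \<le> 3 * (real u ^ 2 * M)" by simp
  have "u \<le> c * u" "c \<le> c * u" "1 \<le> c * u" using assms by auto
  \<comment> \<open>The summands of \<open>W\<close> are at most 2, 5 and 2 times
    \<open>c * u\<close>.\<close>
  then have "W \<le> 9 * (c * u)" "W + 1 \<le> 10 * (c * u)" unfolding W by linarith+
  then have "W * (W + 1) \<le> 9 * (c * u) * (10 * (c * u))" by (rule mult_le_mono)
  then have "real (W * (W + 1)) \<le> real (9 * (c * u) * (10 * (c * u)))" by (simp only: of_nat_le_iff)
  then have W1: "real (W * (W + 1)) \<le> 90 * (real c ^ 2 * real u ^ 2)" by (simp add: power2_eq_square mult_ac)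
  have "real P \<le> real (H + 1) * real (W * (W + 1))"
    using P by (simp only: of_nat_mult[symmetric] of_nat_le_iff)
  also have "\<dots> \<le> 3 * (real u ^ 2 * M) * (90 * (real c ^ 2 * real u ^ 2))"
    using H1 W1 \<open>1 \<le> M\<close> by (intro mult_mono) auto
  also have "\<dots> = 270 * real c ^ 2 * real u ^ 4 * M"
    by (simp add: power2_eq_square power4_eq_xxxx)
  also have "M = (12 * real c) ^ (2 * c) * real u ^ (6 * c) * (1 / \<epsilon>) ^ (2 * c)"
    by (simp add: M_def power_mult_distrib power_divide flip: power_mult)
  also have "(1 / \<epsilon>) ^ (2 * c) = \<epsilon> powr (- 2 * real c)"
    using assms powr_realpow[of \<epsilon> "2 * c"] by (simp add: powr_minus_divide power_one_over)
  finally show ?thesis by (simp add: power_add mult_ac)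
qed

section \<open>Choice of precision, width and the constant\<close>

theorem theorem1p1:
  fixes c :: nat
    and k :: "nat \<Rightarrow> nat"
    and \<dd> :: "nat \<Rightarrow> nat \<Rightarrow> nat"
    and Q :: "nat \<Rightarrow> nat \<Rightarrow> real vec set"
    and g :: "nat \<Rightarrow> nat \<Rightarrow> real vec \<Rightarrow> real vec"
    and F :: "nat \<Rightarrow> real vec \<Rightarrow> real vec"
  assumes "1 \<le> c"
    and "\<And>d. 1 \<le> d \<Longrightarrow> k d \<in> {1..c * d ^ c}"
    and "\<And>d i. 1 \<le> d \<Longrightarrow> i \<in> {1..k d + 1} \<Longrightarrow> \<dd> d i \<in> {1..c * d ^ c}"
    and "\<And>d i. 1 \<le> d \<Longrightarrow> i \<in> {1..k d} \<Longrightarrow> is_hypercube (\<dd> d i) (Q d i)"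
    and "\<And>d i. 1 \<le> d \<Longrightarrow> i \<in> {1..k d} \<Longrightarrow>
           Q d i \<subseteq> cube (\<dd> d i) (- real (c * d ^ c)) (real (c * d ^ c))"
    and "\<And>d i. 1 \<le> d \<Longrightarrow> i \<in> {1..k d} \<Longrightarrow> g d i \<in> cont_funs (\<dd> d i) (Q d i) (\<dd> d (i + 1))"
    and "\<And>d i. 1 \<le> d \<Longrightarrow> i \<in> {1..k d} \<Longrightarrow>
           g d i \<in> lipschitz_class c 1 (Q d i) 1 \<union> max_class (Q d i) \<union> prod_class (Q d i)"
    and "\<And>d i. 1 \<le> d \<Longrightarrow> i \<in> {1..k d - 1} \<Longrightarrow> g d i ` Q d i \<subseteq> Q d (i + 1)"
    and "\<And>d i. 1 \<le> d \<Longrightarrow> i \<in> {1..k d} \<Longrightarrow> g d i \<in> prod_class (Q d i) \<Longrightarrow>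
           Q d i \<subseteq> cube (\<dd> d i) (- 1 / 8) (1 / 8)"
    and "\<And>d. 1 \<le> d \<Longrightarrow> F d \<in> cont_funs (\<dd> d 1) (Q d 1) (\<dd> d (k d + 1))"
    and "\<And>d x. 1 \<le> d \<Longrightarrow> x \<in> Q d 1 \<Longrightarrow> F d x = fold (g d) [1..<k d + 1] x"
  shows "\<exists>K::nat. 1 \<le> K \<and>
    (\<forall>d::nat. 1 \<le> d \<longrightarrow> (\<forall>\<epsilon>::real. 0 < \<epsilon> \<and> \<epsilon> \<le> 1 \<longrightarrow>
      (\<exists>\<Phi> \<in> networks. in_dim \<Phi> = \<dd> d 1 \<and> out_dim \<Phi> = \<dd> d (k d + 1) \<and>
         realize \<Phi> \<in> cont_funs (\<dd> d 1) (carrier_vec (\<dd> d 1)) (\<dd> d (k d + 1)) \<and>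
         real (num_params \<Phi>) \<le> real K * real d ^ K * \<epsilon> powr (- 2 * real c) \<and>
         (\<forall>x \<in> Q d 1. lp_norm 1 (realize \<Phi> x - F d x) \<le> \<epsilon>))))"
proof -
  define p where "p = 6 * c + 4"
  define K\<^sub>0 where "K\<^sub>0 = 270 * c\<^sup>2 * (12 * c) ^ (2 * c)"
  \<comment> \<open>One number serves as factor and as exponent. Since
    \<open>u ^ p = c ^ p * d ^ (c * p)\<close>, it has to dominate both
    \<open>K\<^sub>0 * c ^ p\<close> and \<open>c * p\<close>.\<close>
  define K where "K = K\<^sub>0 * c ^ p + c * p"
  have "\<exists>\<Phi> \<in> networks. in_dim \<Phi> = \<dd> d 1 \<and> out_dim \<Phi> = \<dd> d (k d + 1) \<and>
      realize \<Phi> \<in> cont_funs (\<dd> d 1) (carrier_vec (\<dd> d 1)) (\<dd> d (k d + 1)) \<and>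
      real (num_params \<Phi>) \<le> real K * real d ^ K * \<epsilon> powr (- 2 * real c) \<and>
      (\<forall>x \<in> Q d 1. lp_norm 1 (realize \<Phi> x - F d x) \<le> \<epsilon>)"
    if d: "1 \<le> d" and \<epsilon>: "0 < \<epsilon>" "\<epsilon> \<le> 1" for d :: nat and \<epsilon> :: real
  proof -
    define u where "u = c * d ^ c"
    \<comment> \<open>At most \<open>u\<close> functions with at most \<open>u\<close> steps each
      share the total error \<epsilon>.\<close>
    define \<delta> where "\<delta> = \<epsilon> / real (u * u)"
    \<comment> \<open>Dimensions are at most \<open>u\<close>. The block bound \<open>2 * c\<close>
      is at least \<open>c\<close>, for the Lipschitz blocks, and at least 2, for the binary
      operations; as the exponent in \<open>B\<close> it yields the required power of
      \<epsilon>.\<close>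
    define W where "W = 2 * u + 5 + 2 * c"
    define B where "B = 2 * (6 * real (2 * c) * real u / \<delta>) ^ (2 * c)"
    have u: "1 \<le> u" using assms(1) d by (simp add: u_def)
    have k: "1 \<le> k d" "k d \<le> u" using assms(2)[OF d] by (auto simp: u_def)
    have dims: "1 \<le> \<dd> d i" "\<dd> d i \<le> u" if "i \<in> {1..k d + 1}" for i
      using assms(3)[OF d that] by (auto simp: u_def)
    have uu: "1 \<le> real (u * u)" using mult_le_mono[OF u u] by (simp only: real_of_nat_ge_one_iff mult_1)
    have "0 < real (u * u)" "\<epsilon> \<le> real (u * u)" using uu \<epsilon> by linarith+
    then have \<delta>: "0 < \<delta>" "\<delta> \<le> 1"
      unfolding \<delta>_def using \<epsilon> by (simp_all only: divide_le_eq_1_pos zero_less_divide_iff simp_thms)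
    have "approximable W B \<delta> (\<dd> d i) (\<dd> d (i + 1)) u (Q d i) (g d i)" if i: "i \<in> {1..k d}" for i
      using assms(5-7)[OF d i] assms(9)[OF d i] dims[of i] assms(1) i \<delta>
      by (intro approximable_class[where m = "2 * c" and c = c]) (auto simp: u_def W_def B_def)
    from approximable_fold[of "k d" W B \<delta> "\<dd> d" u "Q d" "g d", OF this assms(8)[OF d] order_refl]
    have "approximable W B \<delta> (\<dd> d 1) (\<dd> d (k d + 1)) (k d * u) (Q d 1) (fold (g d) [1..<k d + 1])"
      by blast
    then obtain H G where H: "real H \<le> real (k d * u) * B" and
      G: "relu_computable W (\<dd> d 1) (\<dd> d (k d + 1)) H G" and
      err: "\<And>x x'. x \<in> Q d 1 \<Longrightarrow> x' \<in> carrier_vec (\<dd> d 1) \<Longrightarrow>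
        l1_dist (\<dd> d (k d + 1)) (G x') (fold (g d) [1..<k d + 1] x)
          \<le> l1_dist (\<dd> d 1) x' x + real (k d * u) * \<delta>"
      unfolding approximable_def by blast
    from G obtain \<Phi> where \<Phi>: "relu_net W (\<dd> d 1) (\<dd> d (k d + 1)) H \<Phi>"
      "\<And>x. x \<in> carrier_vec (\<dd> d 1) \<Longrightarrow> realize \<Phi> x = G x"
      unfolding relu_computable_def by blast
    have dims1: "1 \<le> \<dd> d 1" "\<dd> d 1 \<le> u" "1 \<le> \<dd> d (k d + 1)" "\<dd> d (k d + 1) \<le> u"
      using dims[of 1] dims[of "k d + 1"] by auto
    have T: "real (k d * u) \<le> real (u * u)"
      using k by (simp only: of_nat_le_iff) simp
    have "real (num_params \<Phi>) \<le> real K\<^sub>0 * real u ^ p * \<epsilon> powr (- 2 * real c)"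
      unfolding K\<^sub>0_def p_def
    proof (rule param_bound[OF assms(1) u \<epsilon> _ W_def])
      have "0 \<le> B" using \<delta> by (simp add: B_def)
      then have "real H \<le> real (u * u) * B"
        using H mult_right_mono[OF T, of B] by linarith
      then show "real H \<le> real (u * u) *
          (2 * (6 * real (2 * c) * real u / (\<epsilon> / real (u * u))) ^ (2 * c))"
        by (simp only: B_def \<delta>_def)
      show "num_params \<Phi> \<le> (H + 1) * (W * (W + 1))"
        using dims1 by (intro relu_net_num_params[OF \<Phi>(1)]) (auto simp: W_def)
    qed
    also have "real K\<^sub>0 * real u ^ p = real (K\<^sub>0 * c ^ p) * real d ^ (c * p)"
      by (simp add: u_def power_mult_distrib power_mult)
    also have "\<dots> * \<epsilon> powr (- 2 * real c) \<le> real K * real d ^ K * \<epsilon> powr (- 2 * real c)"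
    proof (intro mult_right_mono mult_mono power_increasing)
      show "real (K\<^sub>0 * c ^ p) \<le> real K" by (simp only: of_nat_le_iff K_def)
      have "1 \<le> K\<^sub>0 * c ^ p" using assms(1) by (simp add: K\<^sub>0_def)
      then show "c * p \<le> K" by (simp add: K_def)
    qed (use d in auto)
    finally have params: "real (num_params \<Phi>) \<le> real K * real d ^ K * \<epsilon> powr (- 2 * real c)" .
    have "lp_norm 1 (realize \<Phi> x - F d x) \<le> \<epsilon>" if x: "x \<in> Q d 1" for x
    proof -
      have Q1: "Q d 1 \<subseteq> carrier_vec (\<dd> d 1)"
        using assms(5)[OF d, of 1] k by (auto simp: cube_def)
      have "F d x \<in> carrier_vec (\<dd> d (k d + 1))"
        using cont_funs_carrier[OF assms(10)[OF d] Q1 x] .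
      moreover have "realize \<Phi> x \<in> carrier_vec (\<dd> d (k d + 1))"
        using relu_net_realize_carrier[OF \<Phi>(1)] Q1 x by blast
      ultimately have "lp_norm 1 (realize \<Phi> x - F d x) = l1_dist (\<dd> d (k d + 1)) (realize \<Phi> x) (F d x)"
        by (rule lp_norm_1_diff[rotated])
      \<comment> \<open>The estimate is used with \<open>x' = x\<close>, so its distance term
        vanishes.\<close>
      also have "\<dots> \<le> l1_dist (\<dd> d 1) x x + real (k d * u) * \<delta>"
        using err[OF x, of x] Q1 x \<Phi>(2) assms(11)[OF d x] by auto
      also have "\<dots> \<le> real (u * u) * \<delta>"
        using mult_right_mono[OF T, of \<delta>] \<delta> by (simp add: l1_dist_def)
      also have "\<dots> = \<epsilon>" using u by (simp add: \<delta>_def)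
      finally show ?thesis .
    qed
    then show ?thesis
      using params relu_net_networks[OF \<Phi>(1)] dims1 relu_net_in_dim[OF \<Phi>(1)]
        relu_net_out_dim[OF \<Phi>(1)] relu_net_cont_funs[OF \<Phi>(1)] by blast
  qed
  moreover have "1 \<le> K"
  proof -
    have "1 \<le> p" by (simp add: p_def)
    then have "1 * 1 \<le> c * p" using assms(1) by (intro mult_le_mono)
    then show ?thesis unfolding K_def by linarith
  qed
  ultimately show ?thesis by blast
qed

end
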